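(* Let $b(x)=\log|x|$ on $\mathbb{R}^n$ and let $T$ be a Calderón–Zygmund operator on $\mathbb{R}^n$. Then there exists a constant $C>0$, depending only on $n$ and $T$, such that for every $f\in C_c^\infty(\mathbb{R}^n)$ and almost every $x\in\mathbb{R}^n$ $$|[b,T]f(x)|\ \le\ C\left(Mf(x)+P^2|f|(x)+(P^* )^2|f|(x)\right).$$
   Context: A (linear) singular integral operator $T$ is one given by $Tf(x)=\int_{\mathbb{R}^n}K(x,y)f(y)\,dy$ for $f\in C_c^\infty(\mathbb{R}^n)$ and almost every $x\notin\operatorname{supp} f$, where $K:\{(x,y)\in\mathbb{R}^n\times\mathbb{R}^n: x\ne y\}\to\mathbb{C}$ satisfies, for some constant $C_K$ and some $\delta>0$: $|K(x,y)|\le C_K|x-y|^{-n}$ whenever $x\neq y$, and $|K(x,y)-K(x,y')|,\ |K(y,x)-K(y',x)|\le C_K\frac{|y-y'|^\delta}{|x-y|^{n+\delta}}$ whenever $|y-y'|\le\frac12|x-y|$. It is a Calderón–Zygmund operator if it extends boundedly on $L^2(\mathbb{R}^n)$; $T$ also denotes the extension. The commutator is $[b,T]f=b\,T(f)-T(bf)$. $Mf(x)=\sup_{r>0}\frac1{|B(x,r)|}\int_{B(x,r)}|f(y)|\,dy$ is the Hardy–Littlewood maximal operator. With $\omega_n$ the volume of the unit ball of $\mathbb{R}^n$, the radial Hardy operator and its adjoint are, for $x\ne0$, $$Pf(x)=\frac1{\omega_n|x|^n}\int_{|y|<|x|}f(y)\,dy,\qquad P^*f(x)=\frac1{\omega_n}\int_{|y|>|x|}\frac{f(y)}{|y|^n}\,dy,$$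 and $P^2=P\circ P$, $(P^* )^2=P^*\circ P^*$. *)

theory Defs
  imports "HOL-Analysis.Analysis"
begin

text \<open>
  Everything is stated over an arbitrary Euclidean space, whose dimension \<open>DIM('a)\<close> plays the
  role of \<open>n\<close>. Elements of \<open>L\<^sup>2\<close> are represented by functions rather than by equivalence classes,
  so identities between them hold almost everywhere.
\<close>

definition supp :: "('a::topological_space \<Rightarrow> 'b::zero) \<Rightarrow> 'a set" where
  "supp f = closure {x. f x \<noteq> 0}"

primrec Ck :: "nat \<Rightarrow> ('a::real_normed_vector \<Rightarrow> 'b::real_normed_vector) \<Rightarrow> bool" where
  "Ck 0 f \<longleftrightarrow> continuous_on UNIV f"
| "Ck (Suc k) f \<longleftrightarrow>
     f differentiable_on UNIV \<and> (\<forall>v. Ck k (\<lambda>x. frechet_derivative f (at x) v))"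

definition test_functions :: "('a::euclidean_space \<Rightarrow> complex) set" where
  "test_functions = {f. (\<forall>k. Ck k f) \<and> compact (supp f)}"

definition L2 :: "('a::euclidean_space \<Rightarrow> complex) set" where
  "L2 = {f \<in> borel_measurable lebesgue. integrable lebesgue (\<lambda>x. (cmod (f x))\<^sup>2)}"

definition L2_norm :: "('a::euclidean_space \<Rightarrow> complex) \<Rightarrow> real" where
  "L2_norm f = sqrt (LINT x|lebesgue. (cmod (f x))\<^sup>2)"

type_synonym 'a operator = "('a \<Rightarrow> complex) \<Rightarrow> ('a \<Rightarrow> complex)"

definition linear_operator_on ::
  "('a::euclidean_space \<Rightarrow> complex) set \<Rightarrow> 'a operator \<Rightarrow> bool" where
  "linear_operator_on X T \<longleftrightarrow>
     (\<forall>f\<in>X. \<forall>g\<in>X. \<forall>\<alpha> \<beta>. AE x in lebesgue.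
        T (\<lambda>y. \<alpha> * f y + \<beta> * g y) x = \<alpha> * T f x + \<beta> * T g x)"

text \<open>The values of \<open>K\<close> on the diagonal are irrelevant.\<close>

definition standard_kernel :: "('a::euclidean_space \<Rightarrow> 'a \<Rightarrow> complex) \<Rightarrow> bool" where
  "standard_kernel K \<longleftrightarrow>
     (\<exists>C \<delta>. \<delta> > 0 \<and>
        (\<forall>x y. x \<noteq> y \<longrightarrow> cmod (K x y) \<le> C / norm (x - y) ^ DIM('a)) \<and>
        (\<forall>x y y'. x \<noteq> y \<and> norm (y - y') \<le> norm (x - y) / 2 \<longrightarrow>
           cmod (K x y - K x y')
             \<le> C * norm (y - y') powr \<delta> / norm (x - y) powr (real DIM('a) + \<delta>) \<and>
           cmod (K y x - K y' x)
             \<le> C * norm (y - y') powr \<delta> / norm (x - y) powr (real DIM('a) + \<delta>)))"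

definition singular_integral_operator :: "('a::euclidean_space) operator \<Rightarrow> bool" where
  "singular_integral_operator T \<longleftrightarrow>
     linear_operator_on test_functions T \<and>
     (\<exists>K. standard_kernel K \<and>
        (\<forall>f\<in>test_functions. AE x in lebesgue.
           x \<notin> supp f \<longrightarrow> T f x = (LINT y|lebesgue. K x y * f y)))"

text \<open>
  Here \<open>T\<close> denotes the \<open>L\<^sup>2\<close>-extension. Linearity and boundedness together imply that
  \<open>T f = T g\<close> almost everywhere whenever \<open>f, g \<in> L2\<close> agree almost everywhere.
\<close>

definition calderon_zygmund_operator :: "('a::euclidean_space) operator \<Rightarrow> bool" where
  "calderon_zygmund_operator T \<longleftrightarrow>
     singular_integral_operator T \<and>
     linear_operator_on L2 T \<and>
     (\<exists>A. \<forall>f\<in>L2. T f \<in> L2 \<and> L2_norm (T f) \<le> A * L2_norm f)"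

definition commutator :: "('a \<Rightarrow> complex) \<Rightarrow> 'a operator \<Rightarrow> 'a operator" where
  "commutator b T f = (\<lambda>x. b x * T f x - T (\<lambda>y. b y * f y) x)"

text \<open>
  The supremum is taken in the reals. For bounded measurable \<open>f\<close>, in particular for test functions,
  the averages are bounded by the supremum norm of \<open>f\<close>.
\<close>

definition maximal_function ::
  "('a::euclidean_space \<Rightarrow> 'b::real_normed_vector) \<Rightarrow> 'a \<Rightarrow> real" where
  "maximal_function f x =
     (SUP r\<in>{0<..}. (LINT y:ball x r|lebesgue. norm (f y)) / measure lebesgue (ball x r))"

text \<open>
  The values of the next two operators at the origin are irrelevant. For a test function \<open>f\<close>, all
  integrals that define \<open>P\<^sup>2 |f|\<close> and \<open>(P\<^sup>*)\<^sup>2 |f|\<close> away from the origin converge.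
\<close>

definition radial_hardy ::
  "('a::euclidean_space \<Rightarrow> 'b::{banach, second_countable_topology}) \<Rightarrow> 'a \<Rightarrow> 'b" where
  "radial_hardy f x =
     (1 / (measure lebesgue (ball (0::'a) 1) * norm x ^ DIM('a))) *\<^sub>R
       (LINT y:{y. norm y < norm x}|lebesgue. f y)"

definition radial_hardy_adj ::
  "('a::euclidean_space \<Rightarrow> 'b::{banach, second_countable_topology}) \<Rightarrow> 'a \<Rightarrow> 'b" where
  "radial_hardy_adj f x =
     (1 / measure lebesgue (ball (0::'a) 1)) *\<^sub>R
       (LINT y:{y. norm y > norm x}|lebesgue. f y /\<^sub>R norm y ^ DIM('a))"

end

theory Submission
  imports Defs
begin

text \<open>
  Formally \<open>[b,T]f(x) = \<integral> (b(x) - b(y)) K(x,y) f(y) dy\<close> with \<open>b = log |\<cdot>|\<close>. The difference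
  \<open>b(x) - b(y)\<close> vanishes to first order on the diagonal, which makes the kernel only weakly singular
  there, so the size condition on \<open>K\<close> already yields an absolutely convergent majorant
  \<open>I(x) = \<integral> |b(x) - b(y)| |x-y|\<^sup>-\<^sup>n |f(y)| dy\<close>. The proof compares the commutator with \<open>I\<close> and then \<open>I\<close>
  with the three operators on the right-hand side.

  \<^bold>\<open>The commutator is dominated by the majorant\<close> (\<open>commutator_le_majorant\<close>). The kernel
  represents \<open>T\<close> only off the support and only on test functions, while \<open>T\<close> may contain a local part
  such as a multiplication operator that \<open>K\<close> does not see. First the representation is extended to
  \<open>L\<^sup>2\<close> functions that vanish off a bounded open set \<open>W\<close>, at almost every point outside the closure of \<open>W\<close>
  (\<open>represented_L2\<close>): the functions that satisfy it are closed under linear combinations and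
  dominated limits, and smooth bumps approximate the indicator function of every open subset of \<open>W\<close>.
  Then, for a small box \<open>Q\<close> away from the origin, write \<open>f = f 1\<^sub>Q + f 1\<^bsub>-Q\<^esub>\<close>. On the interior of \<open>Q\<close>
  the second part contributes at most a constant times \<open>I\<close>. In the first part \<open>b\<close> may be replaced by \<open>b - \<beta>\<close> for a
  constant \<open>\<beta>\<close>, because a commutator with a constant vanishes; if \<open>|b - \<beta>| \<le> \<eta>\<close> on \<open>Q\<close>, boundedness of
  \<open>T\<close> makes its \<open>L\<^sup>2(Q)\<close> norm squared \<open>O(\<eta>\<^sup>2 |Q|)\<close> (\<open>commutator_excess_on_cbox\<close>). Hence the excess of
  \<open>|[b,T]f|\<close> over the majorant has square integral \<open>O(\<eta>\<^sup>2 |Q|)\<close> on \<open>Q\<close>. Adding these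
  bounds over a fine division of a fixed box and letting \<open>\<eta> \<rightarrow> 0\<close> shows that the excess vanishes
  almost everywhere. The local part of \<open>T\<close> is thereby eliminated without being identified.

  \<^bold>\<open>The majorant is dominated by the three operators\<close> (\<open>commutator_majorant_ln_le\<close>). Where
  \<open>|y| \<le> |x|/2\<close> the kernel is at most a constant times \<open>|x|\<^sup>-\<^sup>n log(|x|/|y|)\<close>, and the logarithm is comparable to the
  integral of \<open>|z|\<^sup>-\<^sup>n\<close> over the annulus \<open>|y| < |z| < |x|\<close>; by Tonelli this is an iterated Hardy
  average, which gives \<open>P\<^sup>2|f|\<close>. The region \<open>|y| \<ge> 2|x|\<close> is dual and gives \<open>(P\<^sup>*)\<^sup>2|f|\<close>. In between,
  the logarithm is Lipschitz with constant \<open>2/|x|\<close>, so the kernel is at most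
  \<open>2 |x|\<^sup>-\<^sup>1 |x-y|\<^bsup>1-n\<^esup>\<close>, whose integral against \<open>|f|\<close> over a ball of radius comparable to \<open>|x|\<close> is controlled
  by \<open>Mf(x)\<close>.
\<close>


section \<open>Smooth approximation of indicator functions of open sets\<close>

lemma Ck_SucD: "Ck (Suc k) f \<Longrightarrow> Ck k f"
proof (induction k arbitrary: f)
  case 0
  then show ?case by (auto intro: differentiable_imp_continuous_on)
next
  case (Suc k)
  then show ?case by (metis Ck.simps(2))
qed

lemma Ck_const: "Ck k (\<lambda>x::'a::real_normed_vector. c::'b::real_normed_vector)"
  by (induction k arbitrary: c) auto

lemma Ck_add:
  fixes f g :: "'a::real_normed_vector \<Rightarrow> 'b::real_normed_vector"
  assumes "Ck k f" "Ck k g"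
  shows "Ck k (\<lambda>x. f x + g x)"
  using assms
proof (induction k arbitrary: f g)
  case 0
  then show ?case by (auto intro: continuous_on_add)
next
  case (Suc k)
  have df: "f differentiable (at x)" and dg: "g differentiable (at x)" for x
    using Suc.prems by (auto simp: differentiable_on_def)
  have "frechet_derivative (\<lambda>x. f x + g x) (at x) v =
      frechet_derivative f (at x) v + frechet_derivative g (at x) v" for x v
    using frechet_derivative_at[OF has_derivative_add[OF df[of x, unfolded frechet_derivative_works]
            dg[of x, unfolded frechet_derivative_works]]]
    by (metis)
  then show ?case
    using Suc by (auto intro: differentiable_on_add)
qed

lemma Ck_mult:
  fixes f g :: "'a::real_normed_vector \<Rightarrow> 'b::real_normed_algebra"
  assumes "Ck k f" "Ck k g"
  shows "Ck k (\<lambda>x. f x * g x)"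
  using assms
proof (induction k arbitrary: f g)
  case 0
  then show ?case by (auto intro: continuous_on_mult)
next
  case (Suc k)
  have df: "f differentiable (at x)" and dg: "g differentiable (at x)" for x
    using Suc.prems by (auto simp: differentiable_on_def)
  have "frechet_derivative (\<lambda>x. f x * g x) (at x) v =
      f x * frechet_derivative g (at x) v + frechet_derivative f (at x) v * g x" for x v
    using frechet_derivative_at[OF has_derivative_mult[OF df[of x, unfolded frechet_derivative_works]
            dg[of x, unfolded frechet_derivative_works]]]
    by (metis)
  moreover have "Ck k f" "Ck k g" using Suc.prems Ck_SucD by blast+
  moreover have "(\<lambda>x. f x * g x) differentiable_on UNIV"
    using df dg by (simp add: differentiable_on_def)
  ultimately show ?case
    using Suc by (auto intro!: Ck_add)
qed

lemma Ck_prod: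
  fixes f :: "'i \<Rightarrow> 'a::real_normed_vector \<Rightarrow> 'b::real_normed_field"
  assumes "\<And>i. i \<in> I \<Longrightarrow> Ck k (f i)"
  shows "Ck k (\<lambda>x. \<Prod>i\<in>I. f i x)"
  using assms
  by (induction I rule: infinite_finite_induct) (auto intro: Ck_mult Ck_const)

text \<open>
  The functions \<open>t\<^sup>-\<^sup>m e\<^bsup>-1/t\<^esup>\<close>, continued by \<open>0\<close> to \<open>t \<le> 0\<close>. The powers of \<open>t\<close> are there because the
  derivatives of the classical flat function \<open>m = 0\<close> are linear combinations of them.
\<close>

definition flat_exp :: "nat \<Rightarrow> real \<Rightarrow> real" where
  "flat_exp m t = (if t \<le> 0 then 0 else exp (- (1 / t)) / t ^ m)"

lemma flat_exp_tendsto_0: "(flat_exp m \<longlongrightarrow> 0) (at_right 0)"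
proof -
  have "((\<lambda>u::real. u ^ m / exp u) \<longlongrightarrow> 0) at_top"
    by (rule tendsto_power_div_exp_0)
  then have "((\<lambda>t::real. inverse t ^ m / exp (inverse t)) \<longlongrightarrow> 0) (at_right 0)"
    by (rule filterlim_compose) (rule filterlim_inverse_at_top_right)
  then show ?thesis
    by (rule tendsto_cong[THEN iffD1, rotated])
       (auto simp: eventually_at_filter flat_exp_def exp_minus field_simps)
qed

text \<open>
  At \<open>t = 0\<close> the difference quotient from the right is the next function of the family, which tends
  to \<open>0\<close> because exponential decay beats every power.
\<close>

lemma flat_exp_has_derivative:
  "(flat_exp m has_real_derivative
     (flat_exp (m + 2) t - real m * flat_exp (m + 1) t)) (at t)"
proof -
  consider "t < 0" | "t = 0" | "t > 0" by linarith
  then show ?thesis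
  proof cases
    case 1
    have "((\<lambda>_. 0) has_real_derivative 0) (at t)" by simp
    then have "(flat_exp m has_real_derivative 0) (at t)"
      by (rule DERIV_cong_ev[THEN iffD1, rotated -1, OF _ refl _ refl])
         (use 1 in \<open>auto simp: flat_exp_def intro!: eventually_mono[OF eventually_nhds_in_open[of "{..<0}"]]\<close>)
    with 1 show ?thesis by (simp add: flat_exp_def)
  next
    case 2
    have "((\<lambda>h. flat_exp m h / h) \<longlongrightarrow> 0) (at_right 0)"
      using flat_exp_tendsto_0[of "Suc m"]
      by (rule tendsto_cong[THEN iffD1, rotated])
         (auto simp: eventually_at_filter flat_exp_def)
    moreover have "((\<lambda>h. flat_exp m h / h) \<longlongrightarrow> 0) (at_left 0)"
      by (rule tendsto_eventually) (auto simp: eventually_at_filter flat_exp_def)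
    ultimately have "((\<lambda>h. flat_exp m h / h) \<longlongrightarrow> 0) (at 0)"
      by (simp add: filterlim_at_split)
    with 2 show ?thesis by (simp add: DERIV_def flat_exp_def)
  next
    case 3
    have "((\<lambda>t. exp (- (1 / t)) / t ^ m) has_real_derivative
      (flat_exp (m + 2) t - real m * flat_exp (m + 1) t)) (at t)"
      using 3 by (auto intro!: derivative_eq_intros simp: flat_exp_def field_simps power2_eq_square)
        (cases m; simp add: field_simps power2_eq_square)
    then show ?thesis
      by (rule DERIV_cong_ev[THEN iffD1, rotated -1, OF _ refl _ refl])
         (use 3 in \<open>auto simp: flat_exp_def intro!: eventually_mono[OF eventually_nhds_in_open[of "{0<..}"]]\<close>)
  qed
qed

text \<open>
  The family is closed under differentiation up to linear combinations, so that induction on the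
  order of differentiability works for all its members simultaneously.
\<close>

lemma Ck_flat_exp_affine:
  fixes a :: "'a::real_inner"
  shows "Ck k (\<lambda>x. complex_of_real (flat_exp m (a \<bullet> x + c)))"
proof (induction k arbitrary: m)
  have der: "((\<lambda>x. complex_of_real (flat_exp m (a \<bullet> x + c))) has_derivative
      (\<lambda>v. complex_of_real (a \<bullet> v) *
        (complex_of_real (flat_exp (m + 2) (a \<bullet> x + c)) - of_nat m * complex_of_real (flat_exp (m + 1) (a \<bullet> x + c)))))
      (at x)" for m x
  proof -
    have "((\<lambda>x. a \<bullet> x + c) has_derivative (\<lambda>v. a \<bullet> v)) (at x)"
      by (auto intro!: derivative_eq_intros)
    from has_derivative_of_real[OF DERIV_compose_FDERIV[OF flat_exp_has_derivative this], where 'a = complex]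
    show ?thesis by simp
  qed
  {
    case 0
    show ?case
      unfolding Ck.simps by (intro differentiable_imp_continuous_on)
        (use der in \<open>auto simp: differentiable_on_def differentiable_def\<close>)
  next
    case (Suc k)
    have "frechet_derivative (\<lambda>x. complex_of_real (flat_exp m (a \<bullet> x + c))) (at x) v =
        complex_of_real (a \<bullet> v) *
        (complex_of_real (flat_exp (m + 2) (a \<bullet> x + c)) + (- of_nat m) * complex_of_real (flat_exp (m + 1) (a \<bullet> x + c)))"
      for x v
      using frechet_derivative_at[OF der[of m x]] by (metis diff_conv_add_uminus mult_minus_left)
    moreover have "(\<lambda>x. complex_of_real (flat_exp m (a \<bullet> x + c))) differentiable_on UNIV"
      using der by (auto simp: differentiable_on_def differentiable_def)
    ultimately show ?case
      unfolding Ck.simps by (intro conjI allI; simp only:) (intro Ck_mult Ck_add Ck_const Suc)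
  }
qed

text \<open>
  As \<open>flat_exp 0 (s * u)\<close> tends to \<open>1\<close> for \<open>u > 0\<close> when \<open>s \<rightarrow> \<infinity>\<close>, dilating the flat factors makes
  these bumps converge pointwise to the indicator function of the open box.
\<close>

definition box_bump :: "real \<Rightarrow> 'a::euclidean_space \<Rightarrow> 'a \<Rightarrow> 'a \<Rightarrow> real" where
  "box_bump s c d x =
     (\<Prod>i\<in>Basis. flat_exp 0 (s * (x \<bullet> i - c \<bullet> i)) * flat_exp 0 (s * (d \<bullet> i - x \<bullet> i)))"

lemma flat_exp_0_bounds: "0 \<le> flat_exp 0 t" "flat_exp 0 t \<le> 1"
  by (auto simp: flat_exp_def)

lemma box_bump_bounds: "0 \<le> box_bump s c d x" "box_bump s c d x \<le> 1"
  unfolding box_bump_def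
  by (auto intro!: prod_nonneg prod_le_1 mult_le_one flat_exp_0_bounds mult_nonneg_nonneg)

lemma Ck_box_bump: "Ck k (\<lambda>x. complex_of_real (box_bump s c d x))"
proof -
  have *: "complex_of_real (box_bump s c d x) =
     (\<Prod>i\<in>Basis. complex_of_real (flat_exp 0 ((s *\<^sub>R i) \<bullet> x + (- s * (c \<bullet> i)))) *
        complex_of_real (flat_exp 0 ((- s *\<^sub>R i) \<bullet> x + (s * (d \<bullet> i)))))" for x
    by (simp add: box_bump_def algebra_simps inner_commute)
  show ?thesis
    unfolding * by (intro Ck_prod Ck_mult Ck_flat_exp_affine)
qed

lemma box_bump_eq_0: "x \<notin> box c d \<Longrightarrow> s > 0 \<Longrightarrow> box_bump s c d x = 0"
  by (force simp: box_bump_def flat_exp_def mem_box not_less mult_le_0_iff)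

lemma box_bump_tendsto_1:
  assumes "x \<in> box c d"
  shows "(\<lambda>k. box_bump (real (Suc k)) c d x) \<longlonglongrightarrow> 1"
proof -
  have *: "(\<lambda>k. flat_exp 0 (real (Suc k) * u)) \<longlonglongrightarrow> 1" if "u > 0" for u
  proof -
    have "(\<lambda>k. exp (- (inverse (real (Suc k)) * (1 / u)))) \<longlonglongrightarrow> exp (- (0 * (1 / u)))"
      by (intro tendsto_intros LIMSEQ_inverse_real_of_nat)
    moreover have "flat_exp 0 (real (Suc k) * u) = exp (- (inverse (real (Suc k)) * (1 / u)))" for k
      using that by (simp add: flat_exp_def mult_le_0_iff not_le divide_inverse mult.commute)
    ultimately show ?thesis by simp
  qed
  have "(\<lambda>k. box_bump (real (Suc k)) c d x) \<longlonglongrightarrow> (\<Prod>i\<in>(Basis :: 'a set). 1 * 1)"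
    unfolding box_bump_def
    by (intro tendsto_prod tendsto_mult *) (use assms in \<open>auto simp: mem_box\<close>)
  then show ?thesis by simp
qed

text \<open>
  Write \<open>W\<close> as a countable union of open boxes with bumps \<open>\<psi>\<^sub>j\<close>. The functions \<open>1 - \<Prod>\<^bsub>j<k\<^esub> (1 - \<psi>\<^sub>j)\<close>
  are smooth, vanish off \<open>W\<close>, and at a point of \<open>W\<close> a single factor of the product already tends to
  \<open>0\<close>.
\<close>

lemma test_functions_tendsto_indicator:
  fixes W :: "'a::euclidean_space set"
  assumes W: "open W" "bounded W"
  obtains \<phi> where "\<And>k::nat. \<phi> k \<in> test_functions"
    "\<And>k x. cmod (\<phi> k x) \<le> 1" "\<And>k x. x \<notin> W \<Longrightarrow> \<phi> k x = 0"
    "\<And>x. (\<lambda>k. \<phi> k x) \<longlonglongrightarrow> indicator W x"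
proof -
  obtain \<D> where \<D>: "countable \<D>" "\<D> \<subseteq> Pow W" "\<And>X. X \<in> \<D> \<Longrightarrow> \<exists>a b. X = box a b" "\<Union>\<D> = W"
    using open_countable_Union_open_box[OF W(1)] by metis
  show thesis
  proof (cases "\<D> = {}")
    case True
    then have "W = {}" using \<D> by auto
    then show ?thesis
      by (intro that[of "\<lambda>_ _. 0"]) (auto simp: test_functions_def supp_def Ck_const)
  next
    case False
    define D where "D = from_nat_into \<D>"
    have "D j \<in> \<D>" for j unfolding D_def by (rule from_nat_into[OF False])
    then have "\<exists>a b. D j = box a b" for j using \<D>(3) by blast
    then obtain a where "\<exists>b. D j = box (a j) b" for j by metis
    then obtain b where ab: "D j = box (a j) (b j)" for j by metis
    have DW: "(\<Union>j. D j) = W"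
      using range_from_nat_into[OF False \<D>(1)] \<D>(4) by (simp add: D_def)
    define \<psi> where "\<psi> = (\<lambda>j k x. box_bump (real (Suc k)) (a j) (b j) x)"
    have \<psi>01: "0 \<le> \<psi> j k x" "\<psi> j k x \<le> 1" for j k x
      by (auto simp: \<psi>_def box_bump_bounds)
    \<comment> \<open>The dilation parameter of the bumps and the number of boxes grow together.\<close>
    define p where "p = (\<lambda>k x. \<Prod>j<k. 1 - \<psi> j k x)"
    have p01: "0 \<le> p k x" "p k x \<le> 1" for k x
      using \<psi>01 by (auto simp: p_def intro!: prod_nonneg prod_le_1)
    have out: "p k x = 1" if "x \<notin> W" for k x
      unfolding p_def
      by (rule prod.neutral) (use that DW ab in \<open>auto simp: \<psi>_def intro!: box_bump_eq_0\<close>)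
    have inn: "(\<lambda>k. p k x) \<longlonglongrightarrow> 0" if "x \<in> W" for x
    proof -
      obtain j where "x \<in> D j" using \<open>x \<in> W\<close> DW by blast
      then have j: "x \<in> box (a j) (b j)" by (simp add: ab)
      have lim: "(\<lambda>k. 1 - \<psi> j k x) \<longlonglongrightarrow> 1 - 1"
        unfolding \<psi>_def by (intro tendsto_diff tendsto_const box_bump_tendsto_1 j)
      have le: "p k x \<le> 1 - \<psi> j k x" if "k > j" for k
      proof -
        have "p k x = (1 - \<psi> j k x) * (\<Prod>i\<in>{..<k} - {j}. 1 - \<psi> i k x)"
          unfolding p_def using that by (subst prod.remove[of _ j]) auto
        also have "\<dots> \<le> (1 - \<psi> j k x) * 1"
          using \<psi>01 by (intro mult_left_mono prod_le_1) auto
        finally show ?thesis by simp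
      qed
      show ?thesis
        by (rule tendsto_sandwich[OF _ _ tendsto_const lim[simplified]])
           (use p01 le in \<open>auto intro!: eventually_sequentiallyI[of "Suc j"]\<close>)
    qed
    have Ckp: "Ck m (\<lambda>x. complex_of_real (1 - p k x))" for k m
    proof -
      have *: "complex_of_real (1 - p k x) =
          1 + (- 1) * (\<Prod>j<k. 1 + (- 1) * complex_of_real (\<psi> j k x))" for x
        by (simp add: p_def)
      show ?thesis
        unfolding * \<psi>_def by (intro Ck_add Ck_mult Ck_const Ck_prod Ck_box_bump)
    qed
    have "compact (supp (\<lambda>x. complex_of_real (1 - p k x)))" for k
      unfolding supp_def compact_closure
      by (rule bounded_subset[OF W(2)]) (use out in force)
    moreover have "(\<lambda>k. complex_of_real (1 - p k x)) \<longlonglongrightarrow> indicator W x" for x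
    proof (cases "x \<in> W")
      case True
      have "(\<lambda>k. complex_of_real (1 - p k x)) \<longlonglongrightarrow> of_real (1 - 0)"
        by (intro tendsto_intros inn True)
      with True show ?thesis by simp
    qed (simp add: out)
    ultimately show ?thesis
      using p01 out Ckp
      by (intro that[of "\<lambda>k x. complex_of_real (1 - p k x)"])
         (auto simp: test_functions_def simp del: of_real_diff)
  qed
qed

section \<open>Square-integrable functions\<close>

lemma test_functions_continuous: "f \<in> test_functions \<Longrightarrow> continuous_on UNIV f"
  by (auto simp: test_functions_def dest: spec[of _ "0::nat"])

lemma L2_scaled_add:
  assumes "f \<in> L2" "g \<in> L2"
  shows "(\<lambda>y. \<alpha> * f y + \<beta> * g y) \<in> L2"
proof -
  have [measurable]: "f \<in> borel_measurable lebesgue" "g \<in> borel_measurable lebesgue"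
    using assms by (auto simp: L2_def)
  have "integrable lebesgue (\<lambda>x. (cmod (\<alpha> * f x + \<beta> * g x))\<^sup>2)"
  proof (rule Bochner_Integration.integrable_bound)
    show "integrable lebesgue (\<lambda>x. 2 * (cmod \<alpha>)\<^sup>2 * (cmod (f x))\<^sup>2 + 2 * (cmod \<beta>)\<^sup>2 * (cmod (g x))\<^sup>2)"
      using assms by (auto simp: L2_def)
    have "(cmod (\<alpha> * f x + \<beta> * g x))\<^sup>2 \<le> 2 * (cmod \<alpha>)\<^sup>2 * (cmod (f x))\<^sup>2 + 2 * (cmod \<beta>)\<^sup>2 * (cmod (g x))\<^sup>2" for x
    proof -
      have "(cmod (\<alpha> * f x + \<beta> * g x))\<^sup>2 \<le> (cmod \<alpha> * cmod (f x) + cmod \<beta> * cmod (g x))\<^sup>2"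
        by (intro power_mono) (auto intro: norm_triangle_le simp: norm_mult)
      also have "\<dots> \<le> 2 * (cmod \<alpha> * cmod (f x))\<^sup>2 + 2 * (cmod \<beta> * cmod (g x))\<^sup>2"
        by (smt (verit, best) sum_squares_bound power2_sum)
      finally show ?thesis by (simp add: power_mult_distrib)
    qed
    then show "AE x in lebesgue. norm ((cmod (\<alpha> * f x + \<beta> * g x))\<^sup>2)
        \<le> norm (2 * (cmod \<alpha>)\<^sup>2 * (cmod (f x))\<^sup>2 + 2 * (cmod \<beta>)\<^sup>2 * (cmod (g x))\<^sup>2)"
      by (intro AE_I2) (smt (verit) norm_ge_zero real_norm_def zero_le_power2)
  qed measurable
  then show ?thesis by (simp add: L2_def)
qed

lemma borel_imp_lebesgue: "f \<in> borel_measurable borel \<Longrightarrow> f \<in> borel_measurable lebesgue"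
  by (simp add: measurable_completion)

lemma L2_bounded_by:
  assumes "f \<in> borel_measurable lebesgue" "g \<in> L2" "\<And>x. cmod (f x) \<le> cmod (g x)"
  shows "f \<in> L2"
proof -
  have "integrable lebesgue (\<lambda>x. (cmod (f x))\<^sup>2)"
  proof (rule Bochner_Integration.integrable_bound)
    show "integrable lebesgue (\<lambda>x. (cmod (g x))\<^sup>2)" using assms(2) by (simp add: L2_def)
    show "(\<lambda>x. (cmod (f x))\<^sup>2) \<in> borel_measurable lebesgue" using assms(1) by simp
    show "AE x in lebesgue. norm ((cmod (f x))\<^sup>2) \<le> norm ((cmod (g x))\<^sup>2)"
      by (simp add: power_mono assms(3))
  qed
  with assms(1) show ?thesis by (simp add: L2_def)
qed

lemma indicator_L2:
  assumes "B \<in> sets borel" "bounded B"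
  shows "(\<lambda>x. indicator B x :: complex) \<in> L2"
proof -
  have "emeasure lborel B < \<infinity>" using emeasure_bounded_finite[OF assms(2)] .
  then have "integrable lborel (indicator B :: 'a \<Rightarrow> real)"
    using assms(1) by (simp add: integrable_indicator_iff)
  then have "integrable lebesgue (indicator B :: 'a \<Rightarrow> real)"
    using assms(1) by (simp add: integrable_completion)
  moreover have "(cmod (indicator B x))\<^sup>2 = indicator B x" for x by (simp add: indicator_def)
  ultimately show ?thesis
    using assms(1) by (auto simp: L2_def intro!: borel_imp_lebesgue)
qed

text \<open>
  On a bounded set \<open>|g| \<le> 1 + |g|\<^sup>2\<close>.
\<close>

lemma L2_bounded_support_integrable:
  assumes g: "g \<in> L2" and W: "W \<in> sets borel" "bounded W" "\<And>y. y \<notin> W \<Longrightarrow> g y = 0"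
  shows "integrable lebesgue g"
proof (rule Bochner_Integration.integrable_bound)
  show "g \<in> borel_measurable lebesgue" using g by (simp add: L2_def)
  show "integrable lebesgue (\<lambda>y. (cmod (indicator W y))\<^sup>2 + (cmod (g y))\<^sup>2)"
    using g indicator_L2[OF W(1,2)] by (auto simp: L2_def)
  have "cmod (g y) \<le> (cmod (indicator W y))\<^sup>2 + (cmod (g y))\<^sup>2" for y
    using W(3)[of y] sum_squares_bound[of "cmod (g y)" 1] norm_ge_zero[of "g y"]
    by (cases "y \<in> W") (auto simp del: norm_ge_zero)
  then show "AE y in lebesgue. norm (g y) \<le> norm ((cmod (indicator W y))\<^sup>2 + (cmod (g y))\<^sup>2)"
    by (intro AE_I2) (smt (verit) norm_ge_zero real_norm_def)
qed

lemma L2_norm_nonneg: "0 \<le> L2_norm f"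
  by (simp add: L2_norm_def)

lemma L2_norm_power2: "(L2_norm f)\<^sup>2 = (LINT x|lebesgue. (cmod (f x))\<^sup>2)"
  by (simp add: L2_norm_def)

section \<open>The kernel representation off the support\<close>

text \<open>
  A Calderon-Zygmund operator together with a choice of kernel and constants. Regularity of the
  kernel enters as continuity off the diagonal, which makes \<open>K x\<close> measurable.
\<close>

locale calderon_zygmund_kernel =
  fixes T :: "('a::euclidean_space) operator" and K :: "'a \<Rightarrow> 'a \<Rightarrow> complex" and C A :: real
  assumes linear: "\<And>f g \<alpha> \<beta>. f \<in> L2 \<Longrightarrow> g \<in> L2 \<Longrightarrow>
      AE x in lebesgue. T (\<lambda>y. \<alpha> * f y + \<beta> * g y) x = \<alpha> * T f x + \<beta> * T g x"
    and T_L2: "\<And>f. f \<in> L2 \<Longrightarrow> T f \<in> L2"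
    and T_bound: "\<And>f. f \<in> L2 \<Longrightarrow> L2_norm (T f) \<le> A * L2_norm f"
    and A_nonneg: "0 \<le> A"
    and C_nonneg: "0 \<le> C"
    and size: "\<And>x y. x \<noteq> y \<Longrightarrow> cmod (K x y) \<le> C / norm (x - y) ^ DIM('a)"
    and cont: "\<And>x. continuous_on (- {x}) (K x)"
    and off_support: "\<And>f. f \<in> test_functions \<Longrightarrow>
      AE x in lebesgue. x \<notin> supp f \<longrightarrow> T f x = (LINT y|lebesgue. K x y * f y)"
begin

lemma kernel_measurable: "K x \<in> borel_measurable borel"
proof -
  have "(\<lambda>y. if y \<in> {x} then K x x else K x y) \<in> borel_measurable borel"
    by (rule borel_measurable_continuous_on_if) (use cont in auto)
  also have "(\<lambda>y. if y \<in> {x} then K x x else K x y) = K x" by auto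
  finally show ?thesis .
qed

lemma kernel_bound_off_closure:
  assumes "x \<notin> closure W"
  obtains D where "0 \<le> D" "\<And>y. y \<in> W \<Longrightarrow> cmod (K x y) \<le> D"
proof -
  have "open (- closure W)" "x \<in> - closure W" using assms by auto
  then obtain d where d: "d > 0" "ball x d \<subseteq> - closure W" using openE by blast
  show thesis
  proof (rule that[of "C / d ^ DIM('a)"])
    show "0 \<le> C / d ^ DIM('a)" using d C_nonneg by simp
    fix y assume "y \<in> W"
    then have "y \<notin> ball x d" using d closure_subset by blast
    then have dxy: "d \<le> norm (x - y)" by (simp add: dist_norm)
    then have "cmod (K x y) \<le> C / norm (x - y) ^ DIM('a)"
      using d by (intro size) auto
    also have "\<dots> \<le> C / d ^ DIM('a)"
      using d dxy C_nonneg by (intro divide_left_mono power_mono mult_pos_pos zero_less_power) auto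
    finally show "cmod (K x y) \<le> C / d ^ DIM('a)" .
  qed
qed

lemma kernel_integrable_off_support:
  assumes g: "g \<in> L2" and W: "W \<in> sets borel" "bounded W" "\<And>y. y \<notin> W \<Longrightarrow> g y = 0"
    and x: "x \<notin> closure W"
  shows "integrable lebesgue (\<lambda>y. K x y * g y)"
proof -
  obtain D where D: "0 \<le> D" "\<And>y. y \<in> W \<Longrightarrow> cmod (K x y) \<le> D"
    using kernel_bound_off_closure[OF x] by metis
  show ?thesis
  proof (rule Bochner_Integration.integrable_bound)
    show "integrable lebesgue (\<lambda>y. D * cmod (g y))"
      using L2_bounded_support_integrable[OF g W] by auto
    show "(\<lambda>y. K x y * g y) \<in> borel_measurable lebesgue"
      using borel_imp_lebesgue[OF kernel_measurable[of x]] g by (auto simp: L2_def)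
    have "cmod (K x y * g y) \<le> D * cmod (g y)" for y
      using D W(3)[of y] by (cases "y \<in> W") (auto simp: norm_mult intro: mult_right_mono)
    then show "AE y in lebesgue. norm (K x y * g y) \<le> norm (D * cmod (g y))"
      using D by (auto intro!: AE_I2)
  qed
qed

text \<open>
  The kernel represents \<open>T g\<close> away from the closure of a set that carries \<open>g\<close>.
\<close>

definition represented :: "'a set \<Rightarrow> ('a \<Rightarrow> complex) \<Rightarrow> bool" where
  "represented W g \<longleftrightarrow> g \<in> L2 \<and> (\<forall>x. x \<notin> W \<longrightarrow> g x = 0) \<and>
     (AE x in lebesgue. x \<notin> closure W \<longrightarrow> T g x = (LINT y|lebesgue. K x y * g y))"

lemma represented_scaled_add:
  assumes W: "W \<in> sets borel" "bounded W"
    and f: "represented W f" and g: "represented W g"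
  shows "represented W (\<lambda>y. \<alpha> * f y + \<beta> * g y)"
proof -
  have L: "f \<in> L2" "g \<in> L2" and z: "\<And>x. x \<notin> W \<Longrightarrow> f x = 0" "\<And>x. x \<notin> W \<Longrightarrow> g x = 0"
    and ae: "AE x in lebesgue. x \<notin> closure W \<longrightarrow> T f x = (LINT y|lebesgue. K x y * f y)"
    "AE x in lebesgue. x \<notin> closure W \<longrightarrow> T g x = (LINT y|lebesgue. K x y * g y)"
    using f g by (auto simp: represented_def)
  have "AE x in lebesgue. x \<notin> closure W \<longrightarrow>
      T (\<lambda>y. \<alpha> * f y + \<beta> * g y) x = (LINT y|lebesgue. K x y * (\<alpha> * f y + \<beta> * g y))"
    using ae linear[OF L, of \<alpha> \<beta>]
  proof eventually_elim
    case (elim x)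
    show ?case
    proof
      assume x: "x \<notin> closure W"
      have "(LINT y|lebesgue. K x y * (\<alpha> * f y + \<beta> * g y)) =
          (LINT y|lebesgue. \<alpha> * (K x y * f y) + \<beta> * (K x y * g y))"
        by (simp add: algebra_simps)
      also have "\<dots> = \<alpha> * (LINT y|lebesgue. K x y * f y) + \<beta> * (LINT y|lebesgue. K x y * g y)"
        using kernel_integrable_off_support[OF L(1) W z(1) x]
          kernel_integrable_off_support[OF L(2) W z(2) x]
        by simp
      finally show "T (\<lambda>y. \<alpha> * f y + \<beta> * g y) x = (LINT y|lebesgue. K x y * (\<alpha> * f y + \<beta> * g y))"
        using elim x by simp
    qed
  qed
  then show ?thesis using L2_scaled_add[OF L] z by (auto simp: represented_def)
qed

lemma represented_zero: "W \<in> sets borel \<Longrightarrow> bounded W \<Longrightarrow> represented W g \<Longrightarrow> represented W (\<lambda>_. 0)"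
  using represented_scaled_add[of W g g 0 0] by simp

lemma represented_sum:
  assumes W: "W \<in> sets borel" "bounded W"
    and "represented W g" and "\<And>i. i \<in> I \<Longrightarrow> represented W (f i)"
  shows "represented W (\<lambda>y. \<Sum>i\<in>I. \<alpha> i * f i y)"
  using assms(4)
proof (induction I rule: infinite_finite_induct)
  case (insert i I)
  then show ?case
    using represented_scaled_add[OF W, of "f i" "\<lambda>y. \<Sum>i\<in>I. \<alpha> i * f i y" "\<alpha> i" 1] by simp
qed (use represented_zero[OF W assms(3)] in auto)

text \<open>
  By boundedness \<open>T g\<^sub>k \<rightarrow> T l\<close> in \<open>L\<^sup>2\<close>, hence almost everywhere along a subsequence, while the kernel
  integrals converge at every point outside the closure of \<open>W\<close>, where \<open>K x\<close> is bounded on \<open>W\<close>.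
\<close>

lemma represented_limit:
  assumes W: "W \<in> sets borel" "bounded W"
    and rep: "\<And>k. represented W (g k)"
    and h: "h \<in> L2" and le: "\<And>k x. cmod (g k x) \<le> cmod (h x)"
    and lim: "\<And>x. (\<lambda>k::nat. g k x) \<longlonglongrightarrow> l x"
  shows "represented W l"
proof -
  have gL: "g k \<in> L2" and gz: "x \<notin> W \<Longrightarrow> g k x = 0" for k x
    using rep by (auto simp: represented_def)
  have [measurable]: "g k \<in> borel_measurable lebesgue" for k
    using gL by (simp add: L2_def)
  have [measurable]: "h \<in> borel_measurable lebesgue" using h by (simp add: L2_def)
  have lm[measurable]: "l \<in> borel_measurable lebesgue"
    by (rule borel_measurable_LIMSEQ_metric[OF _ lim]) simp
  have lle: "cmod (l x) \<le> cmod (h x)" for x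
    by (rule tendsto_upperbound[OF tendsto_norm[OF lim[of x]]]) (auto simp: le)
  have lL: "l \<in> L2" by (rule L2_bounded_by[OF lm h lle])
  have lz: "l x = 0" if "x \<notin> W" for x
    using lim[of x] gz[OF that] by (simp add: LIMSEQ_const_iff)
  define e where "e k = (\<lambda>y. 1 * g k y + (- 1) * l y)" for k
  have eL: "e k \<in> L2" for k unfolding e_def by (intro L2_scaled_add gL lL)
  have "(\<lambda>k. LINT x|lebesgue. (cmod (e k x))\<^sup>2) \<longlonglongrightarrow> (LINT (x::'a)|lebesgue. 0)"
  proof (rule integral_dominated_convergence[where w="\<lambda>x. (2 * cmod (h x))\<^sup>2"])
    show "integrable lebesgue (\<lambda>x. (2 * cmod (h x))\<^sup>2)"
      using h by (auto simp: L2_def power_mult_distrib)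
    show "AE x in lebesgue. (\<lambda>k. (cmod (e k x))\<^sup>2) \<longlonglongrightarrow> 0"
    proof (intro AE_I2)
      fix x
      have "(\<lambda>k. (cmod (1 * g k x + (- 1) * l x))\<^sup>2) \<longlonglongrightarrow> (cmod (1 * l x + (- 1) * l x))\<^sup>2"
        by (intro tendsto_intros lim)
      then show "(\<lambda>k. (cmod (e k x))\<^sup>2) \<longlonglongrightarrow> 0" by (simp add: e_def)
    qed
    have "cmod (e k x) \<le> 2 * cmod (h x)" for k x
      using norm_triangle_ineq4[of "g k x" "l x"] le[of k x] lle[of x] by (simp add: e_def)
    then have "(cmod (e k x))\<^sup>2 \<le> (2 * cmod (h x))\<^sup>2" for k x
      by (intro power_mono) auto
    then show "AE x in lebesgue. norm ((cmod (e k x))\<^sup>2) \<le> (2 * cmod (h x))\<^sup>2" for k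
      by simp
  qed (use eL in \<open>auto simp: L2_def\<close>)
  then have e0: "(\<lambda>k. A\<^sup>2 * (L2_norm (e k))\<^sup>2) \<longlonglongrightarrow> 0"
    using tendsto_mult_left[of _ 0 _ "A\<^sup>2"] by (simp add: L2_norm_power2)
  define u where "u = (\<lambda>k x. (cmod (T (e k) x))\<^sup>2)"
  have "\<exists>r. strict_mono r \<and> (AE x in lebesgue. (\<lambda>n. u (r n) x) \<longlonglongrightarrow> 0)"
  proof (rule tendsto_L1_AE_subseq)
    show "integrable lebesgue (u k)" for k
      using T_L2[OF eL[of k]] by (simp add: u_def L2_def)
    have "(LINT x|lebesgue. norm (u k x)) \<le> A\<^sup>2 * (L2_norm (e k))\<^sup>2" for k
      using power_mono[OF T_bound[OF eL[of k]] L2_norm_nonneg, of 2]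
      by (simp add: u_def L2_norm_power2[symmetric] power_mult_distrib)
    then show "(\<lambda>k. LINT x|lebesgue. norm (u k x)) \<longlonglongrightarrow> 0"
      by (intro tendsto_sandwich[OF _ _ tendsto_const e0]) (auto intro!: always_eventually integral_nonneg_AE)
  qed
  then obtain r where r: "strict_mono r" "AE x in lebesgue. (\<lambda>n. u (r n) x) \<longlonglongrightarrow> 0" by blast
  have "AE x in lebesgue. \<forall>k. x \<notin> closure W \<longrightarrow> T (g k) x = (LINT y|lebesgue. K x y * g k y)"
    using rep by (subst AE_all_countable) (auto simp: represented_def)
  moreover have "AE x in lebesgue. \<forall>k. T (e k) x = T (g k) x - T l x"
    unfolding AE_all_countable
  proof
    fix k
    show "AE x in lebesgue. T (e k) x = T (g k) x - T l x"
      using linear[OF gL[of k] lL, of 1 "- 1"] by (simp add: e_def)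
  qed
  ultimately have "AE x in lebesgue. x \<notin> closure W \<longrightarrow> T l x = (LINT y|lebesgue. K x y * l y)"
    using r(2)
  proof eventually_elim
    case (elim x)
    show ?case
    proof
      assume x: "x \<notin> closure W"
      obtain D where D: "0 \<le> D" "\<And>y. y \<in> W \<Longrightarrow> cmod (K x y) \<le> D"
        using kernel_bound_off_closure[OF x] by metis
      have hW: "(\<lambda>y. indicator W y * h y) \<in> L2"
      proof (rule L2_bounded_by[OF _ h])
        have [measurable]: "W \<in> sets lebesgue" using W(1) by simp
        show "(\<lambda>y. indicator W y * h y) \<in> borel_measurable lebesgue" by measurable
      qed (simp add: indicator_def)
      have [measurable]: "K x \<in> borel_measurable lebesgue"
        by (rule borel_imp_lebesgue[OF kernel_measurable])
      have "(\<lambda>k. LINT y|lebesgue. K x y * g k y) \<longlonglongrightarrow> (LINT y|lebesgue. K x y * l y)"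
      proof (rule integral_dominated_convergence[where w="\<lambda>y. D * cmod (indicator W y * h y)"])
        show "integrable lebesgue (\<lambda>y. D * cmod (indicator W y * h y))"
          using L2_bounded_support_integrable[OF hW W] by simp
        show "AE y in lebesgue. (\<lambda>k. K x y * g k y) \<longlonglongrightarrow> K x y * l y"
          by (intro AE_I2 tendsto_intros lim)
        have "cmod (K x y * g k y) \<le> D * cmod (indicator W y * h y)" for k y
          using D gz[of y k] le[of k y]
          by (cases "y \<in> W") (auto simp: norm_mult intro!: mult_mono)
        then show "AE y in lebesgue. norm (K x y * g k y) \<le> D * cmod (indicator W y * h y)" for k
          by simp
      qed auto
      then have "(\<lambda>n. LINT y|lebesgue. K x y * g (r n) y) \<longlonglongrightarrow> (LINT y|lebesgue. K x y * l y)"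
        using LIMSEQ_subseq_LIMSEQ[OF _ r(1)] by (auto simp: o_def)
      moreover have "(\<lambda>n. LINT y|lebesgue. K x y * g (r n) y) \<longlonglongrightarrow> T l x"
      proof -
        have "(\<lambda>n. sqrt (u (r n) x)) \<longlonglongrightarrow> sqrt 0" using elim by (intro tendsto_real_sqrt) auto
        then have "(\<lambda>n. cmod (T (g (r n)) x - T l x)) \<longlonglongrightarrow> 0"
          using elim by (simp add: u_def)
        then have "(\<lambda>n. T (g (r n)) x) \<longlonglongrightarrow> T l x"
          using LIM_zero_iff tendsto_norm_zero_iff by blast
        then show ?thesis using elim x by simp
      qed
      ultimately show "T l x = (LINT y|lebesgue. K x y * l y)"
        using LIMSEQ_unique by blast
    qed
  qed
  then show ?thesis using lL lz by (auto simp: represented_def)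
qed

lemma represented_indicator_open:
  assumes W: "open W" "bounded W" and V: "open V" "V \<subseteq> W"
  shows "represented W (indicator V)"
proof -
  obtain \<phi> where \<phi>: "\<And>k::nat. \<phi> k \<in> test_functions"
    "\<And>k x. cmod (\<phi> k x) \<le> 1" "\<And>k x. x \<notin> V \<Longrightarrow> \<phi> k x = 0"
    "\<And>x. (\<lambda>k. \<phi> k x) \<longlonglongrightarrow> indicator V x"
    by (rule test_functions_tendsto_indicator[OF V(1) bounded_subset[OF W(2) V(2)]]) blast
  have iW: "(\<lambda>x. indicator W x :: complex) \<in> L2" using W by (intro indicator_L2) auto
  have le: "cmod (\<phi> k x) \<le> cmod (indicator W x)" for k x
    using \<phi>(2)[of k x] \<phi>(3)[of x k] V(2) by (auto simp: indicator_def)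
  have "represented W (\<phi> k)" for k
  proof -
    have "\<phi> k \<in> L2"
      by (rule L2_bounded_by[OF _ iW le])
        (intro borel_imp_lebesgue borel_measurable_continuous_onI test_functions_continuous \<phi>)
    moreover
    have "supp (\<phi> k) \<subseteq> closure W"
      unfolding supp_def using \<phi>(3) V(2) by (intro closure_mono) blast
    with off_support[OF \<phi>(1)[of k]]
    have "AE x in lebesgue. x \<notin> closure W \<longrightarrow> T (\<phi> k) x = (LINT y|lebesgue. K x y * \<phi> k y)"
      by (auto elim: eventually_mono)
    ultimately show ?thesis using \<phi>(3) V(2) by (auto simp: represented_def)
  qed
  from represented_limit[OF _ W(2) this iW le \<phi>(4)] W(1) show ?thesis by auto
qed

text \<open>
  Open sets form a generator of the Borel sets that is stable under intersection, so linearity and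
  dominated limits suffice to pass from open to Borel sets.
\<close>

lemma represented_indicator_borel:
  assumes W: "open W" "bounded W" and B: "B \<in> sets borel"
  shows "represented W (indicator (B \<inter> W))"
proof -
  have Wb: "W \<in> sets borel" using W by simp
  have iW: "(\<lambda>x. indicator W x :: complex) \<in> L2" using W by (intro indicator_L2) auto
  note repW = represented_indicator_open[OF W W(1) subset_refl]
  have "Int_stable {S :: 'a set. open S}" by (auto simp: Int_stable_def)
  moreover have "{S :: 'a set. open S} \<subseteq> Pow UNIV" by simp
  moreover have "B \<in> sigma_sets UNIV {S. open S}" using B by (simp add: borel_def)
  ultimately show ?thesis
  proof (induction rule: sigma_sets_induct_disjoint)
    case (basic B)
    then show ?case using W by (intro represented_indicator_open) auto
  next
    case empty
    show ?case using represented_zero[OF Wb W(2) repW] by simp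
  next
    case (compl B)
    have "(indicator ((UNIV - B) \<inter> W) :: 'a \<Rightarrow> complex) =
        (\<lambda>y. 1 * indicator W y + (- 1) * indicator (B \<inter> W) y)"
      by (auto simp: indicator_def fun_eq_iff)
    then show ?case using represented_scaled_add[OF Wb W(2) repW compl(2), of 1 "- 1"] by simp
  next
    case (union B)
    define g where "g = (\<lambda>k y. \<Sum>i<k. 1 * (indicator (B i \<inter> W) y :: complex))"
    have dis: "disjoint_family (\<lambda>i. B i \<inter> W)"
      using union(1) by (auto simp: disjoint_family_on_def)
    have g: "g k y = indicator (\<Union>i<k. B i \<inter> W) y" for k y
      unfolding g_def using dis
      by (subst indicator_UN_disjoint) (auto simp: disjoint_family_on_def)
    have "(\<Union>i. B i) \<inter> W = (\<Union>i. B i \<inter> W)" by auto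
    moreover have "represented W (indicator (\<Union>i. B i \<inter> W))"
    proof (rule represented_limit[OF Wb W(2) _ iW])
      show "represented W (g k)" for k
        unfolding g_def using union by (intro represented_sum[OF Wb W(2) repW]) auto
      show "cmod (g k x) \<le> cmod (indicator W x)" for k x
        by (auto simp: g indicator_def)
      show "(\<lambda>k. g k x) \<longlonglongrightarrow> indicator (\<Union>i. B i \<inter> W) x" for x
        unfolding g by (rule LIMSEQ_indicator_UN)
    qed
    ultimately show ?case by simp
  qed
qed

text \<open>
  Approximation by simple functions dominated by \<open>2|g|\<close>.
\<close>

lemma represented_L2:
  assumes W: "open W" "bounded W"
    and g: "g \<in> L2" "g \<in> borel_measurable borel" "\<And>x. x \<notin> W \<Longrightarrow> g x = 0"
  shows "represented W g"
proof -
  have Wb: "W \<in> sets borel" using W by simp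
  note repW = represented_indicator_open[OF W W(1) subset_refl]
  obtain F where F: "\<And>i::nat. simple_function borel (F i)" "\<And>x. (\<lambda>i. F i x) \<longlonglongrightarrow> g x"
    "\<And>i x. dist (F i x) 0 \<le> 2 * dist (g x) 0"
    using borel_measurable_implies_sequence_metric[OF g(2), of 0] by auto
  have le: "cmod (F i x) \<le> cmod (2 * g x)" for i x using F(3)[of i x] by (simp add: norm_mult)
  have g2: "(\<lambda>x. 2 * g x) \<in> L2" using L2_scaled_add[OF g(1) g(1), of 1 1] by simp
  have "represented W (F i)" for i
  proof -
    have "F i = (\<lambda>x. \<Sum>z\<in>range (F i). z * indicator (F i -` {z} \<inter> W) x)"
    proof
      fix x
      have fin: "finite (range (F i))" using F(1)[of i] by (simp add: simple_function_def)
      have "(\<Sum>z\<in>range (F i). z * indicator (F i -` {z} \<inter> W) x) =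
          (\<Sum>z\<in>range (F i). if F i x = z then z * indicator W x else 0)"
        by (intro sum.cong) (auto simp: indicator_def)
      also have "\<dots> = F i x * indicator W x"
        using fin by (subst sum.delta') auto
      also have "\<dots> = F i x"
        using le[of i x] g(3)[of x] by (cases "x \<in> W") auto
      finally show "F i x = (\<Sum>z\<in>range (F i). z * indicator (F i -` {z} \<inter> W) x)" by simp
    qed
    moreover have "represented W (\<lambda>x. \<Sum>z\<in>range (F i). z * indicator (F i -` {z} \<inter> W) x)"
      using F(1)[of i] by (intro represented_sum[OF Wb W(2) repW] represented_indicator_borel W)
        (auto simp: simple_function_def)
    ultimately show ?thesis by simp
  qed
  from represented_limit[OF Wb W(2) this g2 le F(2)] show ?thesis .
qed

end

section \<open>Domination of the commutator by an absolutely convergent integral\<close>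

text \<open>
  Extended nonnegative values keep the majorant measurable and comparable before its finiteness
  away from the origin is known.
\<close>

definition commutator_majorant :: "('a::euclidean_space \<Rightarrow> real) \<Rightarrow> ('a \<Rightarrow> complex) \<Rightarrow> 'a \<Rightarrow> ennreal" where
  "commutator_majorant b f x =
     (\<integral>\<^sup>+y. ennreal (\<bar>b x - b y\<bar> / norm (x - y) ^ DIM('a) * cmod (f y)) \<partial>lborel)"

lemma commutator_majorant_measurable:
  assumes [measurable]: "b \<in> borel_measurable borel" "f \<in> borel_measurable borel"
  shows "commutator_majorant b f \<in> borel_measurable borel"
  unfolding commutator_majorant_def[abs_def] by measurable

lemma L2_norm_bounded_on_cbox:
  fixes u :: "'a::euclidean_space \<Rightarrow> complex"
  assumes u: "u \<in> borel_measurable lebesgue" "\<And>y. cmod (u y) \<le> D * indicator (cbox c d) y" and D: "0 \<le> D"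
  shows "u \<in> L2" "(L2_norm u)\<^sup>2 \<le> D\<^sup>2 * measure lborel (cbox c d)"
proof -
  have i: "(indicator (cbox c d) :: 'a \<Rightarrow> complex) \<in> L2" by (rule indicator_L2) auto
  then have "(\<lambda>y. of_real D * indicator (cbox c d) y :: complex) \<in> L2"
    using L2_scaled_add[OF i i, of "of_real D" 0] by simp
  then show uL: "u \<in> L2"
  proof (rule L2_bounded_by[OF u(1)])
    show "cmod (u x) \<le> cmod (of_real D * indicator (cbox c d) x)" for x
      using u(2)[of x] D by (cases "x \<in> cbox c d") (auto simp: norm_mult)
  qed
  have int: "integrable lebesgue (indicator (cbox c d) :: 'a \<Rightarrow> real)"
    using lmeasurable_cbox fmeasurableD2 fmeasurableD by (intro integrable_real_indicator) (auto simp: top.not_eq_extremum)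
  have "(L2_norm u)\<^sup>2 \<le> (LINT y|lebesgue. D\<^sup>2 * indicator (cbox c d) y)"
    unfolding L2_norm_power2
  proof (rule integral_mono)
    show "integrable lebesgue (\<lambda>x. (cmod (u x))\<^sup>2)" using uL by (simp add: L2_def)
    show "integrable lebesgue (\<lambda>y. D\<^sup>2 * indicator (cbox c d) y)" using int by simp
    show "(cmod (u y))\<^sup>2 \<le> D\<^sup>2 * indicator (cbox c d) y" for y
      using power_mono[OF u(2)[of y], of 2] by (cases "y \<in> cbox c d") (auto simp: power_mult_distrib)
  qed
  also have "\<dots> = D\<^sup>2 * measure lborel (cbox c d)" by simp
  finally show "(L2_norm u)\<^sup>2 \<le> D\<^sup>2 * measure lborel (cbox c d)" .
qed

context calderon_zygmund_kernel
begin

lemma T_norm_power2_le: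
  assumes "g \<in> L2" "(L2_norm g)\<^sup>2 \<le> E"
  shows "(L2_norm (T g))\<^sup>2 \<le> A\<^sup>2 * E"
  using power_mono[OF T_bound[OF assms(1)] L2_norm_nonneg, of 2]
    mult_left_mono[OF assms(2), of "A\<^sup>2"] by (simp add: power_mult_distrib)

text \<open>
  On the interior of \<open>Q = cbox c d\<close>,
  \<open>[b,T]f = (b - \<beta>) T g - T((b - \<beta>) g) + \<integral> (b(\<cdot>) - b(y)) K(\<cdot>,y) h(y) dy\<close>
  with \<open>g = f 1\<^sub>Q\<close> and \<open>h = f 1\<^bsub>-Q\<^esub>\<close>. The last term is absorbed by the majorant. The first two are
  small in \<open>L\<^sup>2(Q)\<close> because \<open>|b - \<beta>| \<le> \<eta>\<close> on \<open>Q\<close>. The difference is the truncated one of extended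
  nonnegative reals, that is, the positive part of the excess.
\<close>

lemma commutator_excess_on_cbox:
  fixes b :: "'a \<Rightarrow> real" and f :: "'a \<Rightarrow> complex"
  assumes b[measurable]: "b \<in> borel_measurable borel" and f[measurable]: "f \<in> borel_measurable borel"
    and fM: "\<And>y. cmod (f y) \<le> M" and fR: "\<And>y. y \<notin> ball 0 R \<Longrightarrow> f y = 0"
    and bf: "(\<lambda>y. complex_of_real (b y) * f y) \<in> L2"
    and osc: "\<And>y. y \<in> cbox c d \<Longrightarrow> \<bar>b y - \<beta>\<bar> \<le> \<eta>" and \<eta>: "0 \<le> \<eta>"
  shows "(\<integral>\<^sup>+x\<in>cbox c d. (ennreal (cmod (commutator (\<lambda>y. complex_of_real (b y)) T f x))
      - ennreal C * commutator_majorant b f x)\<^sup>2 \<partial>lebesgue) \<le> ennreal (4 * A\<^sup>2 * \<eta>\<^sup>2 * M\<^sup>2 * measure lborel (cbox c d))"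
proof -
  have M: "0 \<le> M" using fM[of 0] norm_ge_zero order_trans by blast
  define Q where "Q = cbox c d"
  have [measurable]: "Q \<in> sets borel" by (simp add: Q_def)
  define B where "B = (\<lambda>y. complex_of_real (b y))"
  have [measurable]: "B \<in> borel_measurable borel" unfolding B_def by measurable
  define g where "g = (\<lambda>y. indicator Q y * f y)"
  define h where "h = (\<lambda>y. indicator (- Q) y * f y)"
  define u where "u = (\<lambda>y. (B y - of_real \<beta>) * g y)"
  have gm[measurable]: "g \<in> borel_measurable borel" unfolding g_def by measurable
  have hm[measurable]: "h \<in> borel_measurable borel" unfolding h_def by measurable
  have um[measurable]: "u \<in> borel_measurable borel" unfolding u_def by measurable
  have gb: "cmod (g y) \<le> M * indicator (cbox c d) y" for y
    using fM[of y] by (simp add: g_def Q_def indicator_def)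
  have ub: "cmod (u y) \<le> (\<eta> * M) * indicator (cbox c d) y" for y
  proof (cases "y \<in> Q")
    case True
    have "cmod (B y - of_real \<beta>) = \<bar>b y - \<beta>\<bar>"
      by (metis B_def norm_of_real of_real_diff real_norm_def)
    then show ?thesis
      using True osc[of y] fM[of y] \<eta> by (auto simp: u_def g_def Q_def norm_mult intro!: mult_mono)
  qed (simp add: u_def g_def Q_def)
  have gL: "g \<in> L2" and gn: "(L2_norm g)\<^sup>2 \<le> M\<^sup>2 * measure lborel Q"
    using L2_norm_bounded_on_cbox[OF borel_imp_lebesgue[OF gm] gb M] by (auto simp: Q_def)
  have uL: "u \<in> L2" and un: "(L2_norm u)\<^sup>2 \<le> (\<eta> * M)\<^sup>2 * measure lborel Q"
    using L2_norm_bounded_on_cbox[OF borel_imp_lebesgue[OF um] ub] M \<eta> by (auto simp: Q_def)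
  have Bg: "(\<lambda>y. B y * g y) = (\<lambda>y. of_real \<beta> * g y + 1 * u y)"
    by (simp add: u_def algebra_simps)
  have BgL: "(\<lambda>y. B y * g y) \<in> L2" unfolding Bg by (rule L2_scaled_add[OF gL uL])
  have BhL: "(\<lambda>y. B y * h y) \<in> L2"
    by (rule L2_bounded_by[OF _ bf]) (auto intro!: borel_imp_lebesgue simp: B_def h_def indicator_def)
  have hL: "h \<in> L2"
  proof (rule L2_bounded_by)
    have i: "(indicator (ball 0 R) :: 'a \<Rightarrow> complex) \<in> L2" by (rule indicator_L2) auto
    then show "(\<lambda>y::'a. of_real M * indicator (ball 0 R) y :: complex) \<in> L2"
      using L2_scaled_add[OF i i, of "of_real M" 0] by simp
    show "h \<in> borel_measurable lebesgue" by (rule borel_imp_lebesgue) simp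
    show "cmod (h x) \<le> cmod (of_real M * indicator (ball 0 R) x)" for x
      using fM[of x] fR[of x] M by (auto simp: h_def indicator_def norm_mult)
  qed
  have f_split: "f = (\<lambda>y. 1 * g y + 1 * h y)"
    by (auto simp: g_def h_def indicator_def)
  have Bf_split: "(\<lambda>y. B y * f y) = (\<lambda>y. 1 * (B y * g y) + 1 * (B y * h y))"
    by (auto simp: g_def h_def indicator_def)
  define W where "W = ball 0 R - Q"
  have W: "open W" "bounded W" by (auto simp: W_def Q_def intro!: open_Diff bounded_subset[OF bounded_ball])
  have hW: "h y = 0" if "y \<notin> W" for y
    using that fR[of y] by (auto simp: W_def h_def indicator_def)
  have rep: "represented W h" "represented W (\<lambda>y. B y * h y)"
    using hW by (auto intro!: represented_L2 W hL BhL)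
  have clW: "x \<notin> closure W" if "x \<in> box c d" for x
  proof -
    have "box c d \<inter> W = {}" using box_subset_cbox[of c d] by (auto simp: W_def Q_def)
    then have "box c d \<inter> closure W = {}" using open_Int_closure_eq_empty[OF open_box] by blast
    with that show ?thesis by blast
  qed
  let ?N = "\<lambda>x. 2 * \<eta>\<^sup>2 * (cmod (T g x))\<^sup>2 + 2 * (cmod (T u x))\<^sup>2"
  let ?G = "\<lambda>x. (ennreal (cmod (commutator B T f x)) - ennreal C * commutator_majorant b f x)\<^sup>2"
  have "AE x in lebesgue. x \<in> box c d \<longrightarrow> ?G x \<le> ennreal (?N x)"
    using linear[OF gL hL, of 1 1] linear[OF BgL BhL, of 1 1] linear[OF gL uL, of "of_real \<beta>" 1]
      rep[unfolded represented_def, THEN conjunct2, THEN conjunct2]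
  proof eventually_elim
    case (elim x)
    show ?case
    proof
      assume x: "x \<in> box c d"
      note xW = clW[OF x]
      have Wb: "W \<in> sets borel" using W by simp
      have i1: "integrable lebesgue (\<lambda>y. K x y * h y)"
        by (rule kernel_integrable_off_support[OF hL Wb W(2) hW xW])
      have i2: "integrable lebesgue (\<lambda>y. K x y * (B y * h y))"
        using hW by (intro kernel_integrable_off_support[OF BhL Wb W(2) _ xW]) auto
      let ?k = "\<lambda>y. B x * (K x y * h y) - K x y * (B y * h y)"
      have ik: "integrable lebesgue ?k" using i1 i2 by simp
      have "commutator B T f x = (B x - of_real \<beta>) * T g x - T u x + (LINT y|lebesgue. ?k y)"
      proof -
        have "T f x = T g x + T h x" using elim(1) f_split by simp
        moreover have "T (\<lambda>y. B y * f y) x = of_real \<beta> * T g x + T u x + T (\<lambda>y. B y * h y) x"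
          using elim(2,3) Bf_split Bg by simp
        moreover have "(LINT y|lebesgue. ?k y) = B x * T h x - T (\<lambda>y. B y * h y) x"
          using elim(4,5) xW i1 i2 by simp
        ultimately show ?thesis by (simp add: commutator_def algebra_simps)
      qed
      also have "cmod \<dots> \<le> (cmod ((B x - of_real \<beta>) * T g x) + cmod (T u x)) + cmod (LINT y|lebesgue. ?k y)"
        by (intro norm_triangle_le add_mono norm_triangle_ineq4 order_refl)
      also have "\<dots> \<le> (\<eta> * cmod (T g x) + cmod (T u x)) + cmod (LINT y|lebesgue. ?k y)"
      proof -
        have "cmod (B x - of_real \<beta>) = \<bar>b x - \<beta>\<bar>"
          by (metis B_def norm_of_real of_real_diff real_norm_def)
        then have "cmod (B x - of_real \<beta>) \<le> \<eta>" using osc[of x] x box_subset_cbox[of c d] by auto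
        then show ?thesis by (simp add: norm_mult mult_right_mono)
      qed
      finally have 1: "cmod (commutator B T f x) \<le> (\<eta> * cmod (T g x) + cmod (T u x)) + cmod (LINT y|lebesgue. ?k y)" .
      have km[measurable]: "K x \<in> borel_measurable borel" by (rule kernel_measurable)
      have 2: "ennreal (cmod (LINT y|lebesgue. ?k y)) \<le> ennreal C * commutator_majorant b f x"
      proof -
        have "ennreal (cmod (LINT y|lebesgue. ?k y)) \<le> (\<integral>\<^sup>+y. ennreal (cmod (?k y)) \<partial>lebesgue)"
          by (rule integral_norm_bound_ennreal[OF ik])
        also have "\<dots> = (\<integral>\<^sup>+y. ennreal (cmod (?k y)) \<partial>lborel)" by (rule nn_integral_completion)
        also have "\<dots> \<le> (\<integral>\<^sup>+y. ennreal C * ennreal (\<bar>b x - b y\<bar> / norm (x - y) ^ DIM('a) * cmod (f y)) \<partial>lborel)"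
        proof (rule nn_integral_mono)
          fix y
          show "ennreal (cmod (?k y)) \<le> ennreal C * ennreal (\<bar>b x - b y\<bar> / norm (x - y) ^ DIM('a) * cmod (f y))"
          proof (cases "y \<in> Q")
            case False
            with x box_subset_cbox[of c d] have "x \<noteq> y" by (auto simp: Q_def)
            have "?k y = (B x - B y) * K x y * f y" using False by (simp add: h_def algebra_simps)
            moreover have "cmod (B x - B y) = \<bar>b x - b y\<bar>"
              by (metis B_def norm_of_real of_real_diff real_norm_def)
            ultimately have "cmod (?k y) = \<bar>b x - b y\<bar> * cmod (K x y) * cmod (f y)"
              by (simp add: norm_mult)
            also have "\<dots> \<le> \<bar>b x - b y\<bar> * (C / norm (x - y) ^ DIM('a)) * cmod (f y)"
              by (intro mult_right_mono mult_left_mono size \<open>x \<noteq> y\<close>) auto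
            finally show ?thesis
              using C_nonneg by (simp add: ennreal_mult'[symmetric] field_simps)
          qed (simp add: h_def)
        qed
        also have "\<dots> = ennreal C * commutator_majorant b f x"
          unfolding commutator_majorant_def by (rule nn_integral_cmult) measurable
        finally show ?thesis .
      qed
      have "ennreal (cmod (commutator B T f x)) \<le>
          ennreal (\<eta> * cmod (T g x) + cmod (T u x)) + ennreal C * commutator_majorant b f x"
        using 2 ennreal_leI[OF 1] \<eta>
        by (subst (asm) ennreal_plus) (auto intro: order_trans[OF _ add_left_mono])
      then have "ennreal (cmod (commutator B T f x)) - ennreal C * commutator_majorant b f x
          \<le> ennreal (\<eta> * cmod (T g x) + cmod (T u x))"
        by (simp add: ennreal_minus_le_iff add.commute)
      then have "?G x \<le> (ennreal (\<eta> * cmod (T g x) + cmod (T u x)))\<^sup>2"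
        by (rule power_mono) simp
      also have "\<dots> = ennreal ((\<eta> * cmod (T g x) + cmod (T u x))\<^sup>2)"
        using \<eta> by (simp add: ennreal_power del: ennreal_plus)
      also have "\<dots> \<le> ennreal (?N x)"
      proof (rule ennreal_leI)
        have "(s + t)\<^sup>2 \<le> 2 * s\<^sup>2 + 2 * t\<^sup>2" for s t :: real
          using sum_squares_bound[of s t] by (simp add: power2_sum)
        from this[of "\<eta> * cmod (T g x)" "cmod (T u x)"]
        show "(\<eta> * cmod (T g x) + cmod (T u x))\<^sup>2 \<le> ?N x" by (simp add: power_mult_distrib)
      qed
      finally show "?G x \<le> ennreal (?N x)" .
    qed
  qed
  moreover have "AE x in lebesgue. x \<notin> cbox c d - box c d"
    by (rule AE_not_in) (metis negligible_frontier_interval negligible_iff_null_sets)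
  ultimately have "(\<integral>\<^sup>+x\<in>cbox c d. ?G x \<partial>lebesgue) \<le> (\<integral>\<^sup>+x. ennreal (?N x) \<partial>lebesgue)"
    by (intro nn_integral_mono_AE) (auto simp: indicator_def elim: eventually_elim2)
  also have "\<dots> = ennreal (LINT x|lebesgue. ?N x)"
    using T_L2[OF gL] T_L2[OF uL] by (intro nn_integral_eq_integral) (auto simp: L2_def)
  also have "\<dots> = ennreal (2 * \<eta>\<^sup>2 * (L2_norm (T g))\<^sup>2 + 2 * (L2_norm (T u))\<^sup>2)"
    using T_L2[OF gL] T_L2[OF uL] by (simp add: L2_def L2_norm_power2)
  also have "\<dots> \<le> ennreal (4 * A\<^sup>2 * \<eta>\<^sup>2 * M\<^sup>2 * measure lborel Q)"
  proof (rule ennreal_leI)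
    have "2 * \<eta>\<^sup>2 * (L2_norm (T g))\<^sup>2 + 2 * (L2_norm (T u))\<^sup>2
        \<le> 2 * \<eta>\<^sup>2 * (A\<^sup>2 * (M\<^sup>2 * measure lborel Q)) + 2 * (A\<^sup>2 * ((\<eta> * M)\<^sup>2 * measure lborel Q))"
      by (intro add_mono mult_left_mono T_norm_power2_le gL uL gn un) auto
    then show "2 * \<eta>\<^sup>2 * (L2_norm (T g))\<^sup>2 + 2 * (L2_norm (T u))\<^sup>2 \<le> 4 * A\<^sup>2 * \<eta>\<^sup>2 * M\<^sup>2 * measure lborel Q"
      by (simp add: power_mult_distrib mult_ac)
  qed
  finally show ?thesis by (simp add: Q_def B_def)
qed

text \<open>
  The bound \<open>O(\<eta>\<^sup>2 |Q|)\<close> is additive over the boxes \<open>Q\<close> of a division. Continuity of \<open>b\<close> provides, for every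
  \<open>\<eta> > 0\<close>, a gauge such that \<open>b\<close> oscillates by at most \<open>\<eta>\<close> about the tag on each box of a fine
  tagged division, so the excess has square integral \<open>O(\<eta>\<^sup>2)\<close> on each fixed box.
\<close>

lemma commutator_le_majorant:
  fixes b :: "'a \<Rightarrow> real" and f :: "'a \<Rightarrow> complex"
  assumes b[measurable]: "b \<in> borel_measurable borel" and f[measurable]: "f \<in> borel_measurable borel"
    and fM: "\<And>y. cmod (f y) \<le> M" and fR: "\<And>y. y \<notin> ball 0 R \<Longrightarrow> f y = 0"
    and fL: "f \<in> L2" and bf: "(\<lambda>y. complex_of_real (b y) * f y) \<in> L2"
    and U: "open U" "continuous_on U b"
  shows "AE x in lebesgue. x \<in> U \<longrightarrow>
      ennreal (cmod (commutator (\<lambda>y. complex_of_real (b y)) T f x)) \<le> ennreal C * commutator_majorant b f x"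
proof -
  let ?G = "\<lambda>x. (ennreal (cmod (commutator (\<lambda>y. complex_of_real (b y)) T f x))
      - ennreal C * commutator_majorant b f x)\<^sup>2"
  have [measurable]: "commutator_majorant b f \<in> borel_measurable lebesgue"
    by (intro measurable_completion) (simp add: commutator_majorant_measurable b f)
  have [measurable]: "T f \<in> borel_measurable lebesgue" "T (\<lambda>y. complex_of_real (b y) * f y) \<in> borel_measurable lebesgue"
    using T_L2[OF fL] T_L2[OF bf] by (auto simp: L2_def)
  have [measurable]: "b \<in> borel_measurable lebesgue" by (intro measurable_completion) simp
  have Gm[measurable]: "?G \<in> borel_measurable lebesgue"
    unfolding commutator_def by measurable
  have zero: "(\<integral>\<^sup>+x\<in>cbox p q. ?G x \<partial>lebesgue) = 0" if pq: "cbox p q \<subseteq> U" for p q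
  proof -
    define L where "L = 4 * A\<^sup>2 * M\<^sup>2 * measure lborel (cbox p q)"
    have L: "0 \<le> L" by (simp add: L_def)
    have bound: "(\<integral>\<^sup>+x\<in>cbox p q. ?G x \<partial>lebesgue) \<le> ennreal (\<eta>\<^sup>2 * L)" if \<eta>: "\<eta> > 0" for \<eta>
    proof -
      define \<gamma> where "\<gamma> = (\<lambda>x. if x \<in> U then U \<inter> b -` ball (b x) \<eta> else UNIV)"
      have "gauge \<gamma>"
        unfolding gauge_def \<gamma>_def using \<eta> U
        by (auto intro: continuous_open_preimage)
      then obtain P where P: "P tagged_division_of cbox p q" "\<gamma> fine P"
        using fine_division_exists by blast
      have fin: "finite P" using P(1) by blast
      have cover: "?G x * indicator (cbox p q) x \<le> (\<Sum>(t, k)\<in>P. ?G x * indicator k x)" for x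
      proof (cases "x \<in> cbox p q")
        case True
        then have "x \<in> \<Union>{k. \<exists>t. (t, k) \<in> P}" using P(1) unfolding tagged_division_of_def by blast
        then obtain t k where tk: "(t, k) \<in> P" "x \<in> k" by blast
        have "?G x * indicator (cbox p q) x = (\<Sum>(t, k)\<in>{(t, k)}. ?G x * indicator k x)"
          using True tk by simp
        also have "\<dots> \<le> (\<Sum>(t, k)\<in>P. ?G x * indicator k x)"
          using tk fin by (intro sum_mono2) auto
        finally show ?thesis .
      qed simp
      have piece: "(\<integral>\<^sup>+x. ?G x * indicator k x \<partial>lebesgue) \<le> ennreal (4 * A\<^sup>2 * \<eta>\<^sup>2 * M\<^sup>2 * measure lborel k)"
        and km: "k \<in> sets lebesgue" if tk: "(t, k) \<in> P" for t k
      proof -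
        obtain c d where k: "k = cbox c d" using P(1) tk by blast
        then show "k \<in> sets lebesgue" by simp
        have "t \<in> k" "k \<subseteq> cbox p q" using P(1) tk by blast+
        then have "t \<in> U" using pq by blast
        have "k \<subseteq> \<gamma> t" using P(2) tk by (auto simp: fine_def)
        then have "\<bar>b y - b t\<bar> \<le> \<eta>" if "y \<in> cbox c d" for y
          using that \<open>t \<in> U\<close> k by (auto simp: \<gamma>_def dist_real_def)
        from commutator_excess_on_cbox[OF b f fM fR bf this] \<eta>
        show "(\<integral>\<^sup>+x. ?G x * indicator k x \<partial>lebesgue) \<le> ennreal (4 * A\<^sup>2 * \<eta>\<^sup>2 * M\<^sup>2 * measure lborel k)"
          by (simp add: k)
      qed
      have "(\<integral>\<^sup>+x\<in>cbox p q. ?G x \<partial>lebesgue) \<le> (\<integral>\<^sup>+x. (\<Sum>(t, k)\<in>P. ?G x * indicator k x) \<partial>lebesgue)"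
        by (intro nn_integral_mono cover)
      also have "\<dots> = (\<Sum>z\<in>P. \<integral>\<^sup>+x. ?G x * indicator (snd z) x \<partial>lebesgue)"
        unfolding case_prod_unfold
      proof (rule nn_integral_sum)
        fix z assume "z \<in> P"
        then have [measurable]: "snd z \<in> sets lebesgue" using km[of "fst z" "snd z"] by simp
        show "(\<lambda>x. ?G x * indicator (snd z) x) \<in> borel_measurable lebesgue" by measurable
      qed
      also have "\<dots> \<le> (\<Sum>z\<in>P. ennreal (4 * A\<^sup>2 * \<eta>\<^sup>2 * M\<^sup>2 * measure lborel (snd z)))"
        by (intro sum_mono) (auto intro: piece)
      also have "\<dots> = ennreal (\<Sum>z\<in>P. 4 * A\<^sup>2 * \<eta>\<^sup>2 * M\<^sup>2 * measure lborel (snd z))"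
        by (rule sum_ennreal) simp
      also have "(\<Sum>z\<in>P. 4 * A\<^sup>2 * \<eta>\<^sup>2 * M\<^sup>2 * measure lborel (snd z)) = \<eta>\<^sup>2 * L"
        using additive_content_tagged_division[OF P(1)]
        by (subst sum_distrib_left[symmetric]) (simp add: case_prod_unfold L_def mult_ac)
      finally show ?thesis .
    qed
    have "(\<integral>\<^sup>+x\<in>cbox p q. ?G x \<partial>lebesgue) \<le> 0"
    proof (rule ennreal_le_epsilon)
      fix e :: real assume e: "e > 0"
      \<comment> \<open>The bound with \<open>\<eta>\<^sup>2 = e / (L + 1)\<close>; the summand \<open>1\<close> covers the case \<open>L = 0\<close>.\<close>
      have "(\<integral>\<^sup>+x\<in>cbox p q. ?G x \<partial>lebesgue) \<le> ennreal ((sqrt (e / (L + 1)))\<^sup>2 * L)"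
        using e L by (intro bound) simp
      also have "\<dots> \<le> ennreal e"
        using e L by (intro ennreal_leI) (simp add: field_simps)
      finally show "(\<integral>\<^sup>+x\<in>cbox p q. ?G x \<partial>lebesgue) \<le> 0 + ennreal e" by simp
    qed
    then show ?thesis by simp
  qed
  obtain \<D> where \<D>: "countable \<D>" "\<D> \<subseteq> Pow U" "\<And>X. X \<in> \<D> \<Longrightarrow> \<exists>a b. X = cbox a b" "\<Union>\<D> = U"
    using open_countable_Union_open_cbox[OF U(1)] by metis
  have "AE x in lebesgue. \<forall>X\<in>\<D>. x \<in> X \<longrightarrow> ?G x = 0"
  proof (rule AE_ball_countable'[OF _ \<D>(1)])
    fix X assume X: "X \<in> \<D>"
    then obtain p q where pq: "X = cbox p q" using \<D>(3) by blast
    then have "(\<integral>\<^sup>+x. ?G x * indicator X x \<partial>lebesgue) = 0" using X zero \<D>(2) by auto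
    moreover have "(\<lambda>x. ?G x * indicator X x) \<in> borel_measurable lebesgue"
      using pq by (intro borel_measurable_times_ennreal Gm borel_measurable_indicator) simp
    ultimately have "AE x in lebesgue. ?G x * indicator X x = 0"
      by (simp only: nn_integral_0_iff_AE)
    then show "AE x in lebesgue. x \<in> X \<longrightarrow> ?G x = 0"
      by eventually_elim (auto simp: indicator_def)
  qed
  then show ?thesis
  proof eventually_elim
    case (elim x)
    show ?case
    proof
      assume "x \<in> U"
      then have "?G x = 0" using elim \<D>(4) by blast
      then show "ennreal (cmod (commutator (\<lambda>y. complex_of_real (b y)) T f x)) \<le> ennreal C * commutator_majorant b f x"
        by (simp add: ennreal_minus_eq_0)
    qed
  qed
qed

end

section \<open>Logarithms and powers as radial integrals\<close>

text \<open>
  The annulus contains \<open>k\<close> disjoint dyadic shells. Each of them has weight at least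
  \<open>\<omega>\<^sub>n (1 - 2\<^sup>-\<^sup>n) \<ge> \<omega>\<^sub>n / 2\<close>, independently of its radius.
\<close>

lemma annulus_weight_lower_bound:
  fixes r R :: real
  assumes "0 < r" "2 ^ k * r \<le> R"
  shows "ennreal (real k * unit_ball_vol DIM('a) / 2) \<le>
    (\<integral>\<^sup>+z. ennreal (1 / norm z ^ DIM('a)) * indicator {z. r < norm z \<and> norm z < R} z \<partial>(lborel :: 'a::euclidean_space measure))"
  using assms
proof (induction k arbitrary: r)
  case (Suc k)
  let ?n = "DIM('a)" and ?v = "unit_ball_vol DIM('a)"
  let ?w = "\<lambda>z::'a. ennreal (1 / norm z ^ ?n)"
  have shell: "ennreal (?v / 2) \<le> (\<integral>\<^sup>+z. ?w z * indicator {z. r < norm z \<and> norm z < 2 * r} z \<partial>lborel)"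
  proof -
    have set: "{z::'a. r < norm z \<and> norm z < 2 * r} = ball 0 (2 * r) - cball 0 r"
      by (auto simp: dist_norm)
    have "(2::real) ^ 1 \<le> 2 ^ ?n" by (intro power_increasing) (auto simp: Suc_leI)
    then have "?v / 2 \<le> 1 / (2 * r) ^ ?n * (?v * (2 * r) ^ ?n - ?v * r ^ ?n)"
      using Suc.prems(1) by (simp add: power_mult_distrib field_simps)
    then have "ennreal (?v / 2) \<le> ennreal (1 / (2 * r) ^ ?n) * ennreal (?v * (2 * r) ^ ?n - ?v * r ^ ?n)"
      using Suc.prems(1) by (simp add: ennreal_mult'[symmetric] ennreal_leI)
    also have "ennreal (?v * (2 * r) ^ ?n - ?v * r ^ ?n) = emeasure lborel (ball (0::'a) (2 * r)) - emeasure lborel (cball (0::'a) r)"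
      using Suc.prems(1) by (simp add: emeasure_ball emeasure_cball ennreal_minus)
    also have "\<dots> = emeasure lborel (ball (0::'a) (2 * r) - cball 0 r)"
      using Suc.prems(1) by (intro emeasure_Diff[symmetric]) (auto simp: emeasure_cball dist_norm)
    also have "ennreal (1 / (2 * r) ^ ?n) * \<dots> =
        (\<integral>\<^sup>+z. ennreal (1 / (2 * r) ^ ?n) * indicator (ball (0::'a) (2 * r) - cball 0 r) z \<partial>lborel)"
      by (subst nn_integral_cmult_indicator) auto
    also have "\<dots> \<le> (\<integral>\<^sup>+z. ?w z * indicator {z. r < norm z \<and> norm z < 2 * r} z \<partial>lborel)"
      unfolding set[symmetric]
    proof (rule nn_integral_mono)
      fix z :: 'a
      have "1 / (2 * r) ^ ?n \<le> 1 / norm z ^ ?n" if "r < norm z" "norm z < 2 * r"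
        using that Suc.prems(1) by (intro divide_left_mono power_mono mult_pos_pos zero_less_power) auto
      then show "ennreal (1 / (2 * r) ^ ?n) * indicator {z. r < norm z \<and> norm z < 2 * r} z
          \<le> ?w z * indicator {z. r < norm z \<and> norm z < 2 * r} z"
        by (auto simp: indicator_def simp del: power_mult_distrib intro!: ennreal_leI)
    qed
    finally show ?thesis .
  qed
  have "r \<le> 2 ^ k * r" using Suc.prems(1) by simp
  then have rR: "2 * r \<le> R" using Suc.prems(2) by simp
  have "ennreal (real (Suc k) * ?v / 2) = ennreal (?v / 2) + ennreal (real k * ?v / 2)"
    by (simp add: ennreal_plus[symmetric] field_simps del: ennreal_plus)
  also have "\<dots> \<le> (\<integral>\<^sup>+z. ?w z * indicator {z. r < norm z \<and> norm z < 2 * r} z \<partial>lborel)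
      + (\<integral>\<^sup>+z. ?w z * indicator {z. 2 * r < norm z \<and> norm z < R} z \<partial>lborel)"
    using Suc.IH[of "2 * r"] Suc.prems by (intro add_mono shell) (auto simp: mult_ac)
  also have "\<dots> = (\<integral>\<^sup>+z. ?w z * indicator {z. r < norm z \<and> norm z < 2 * r} z
      + ?w z * indicator {z. 2 * r < norm z \<and> norm z < R} z \<partial>lborel)"
    by (rule nn_integral_add[symmetric]) measurable
  also have "\<dots> \<le> (\<integral>\<^sup>+z. ?w z * indicator {z. r < norm z \<and> norm z < R} z \<partial>lborel)"
    using rR Suc.prems(1) by (intro nn_integral_mono) (auto simp: indicator_def)
  finally show ?case .
qed simp

text \<open>
  With \<open>k = \<lfloor>log\<^sub>2 (R/r)\<rfloor> \<ge> 1\<close> shells, \<open>ln (R/r) \<le> k + 1 \<le> 2k\<close>.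
\<close>

lemma ln_le_annulus_weight:
  fixes r R :: real
  assumes r: "0 < r" and rR: "2 * r \<le> R"
  shows "ennreal (ln (R / r)) \<le> ennreal (4 / unit_ball_vol DIM('a)) *
    (\<integral>\<^sup>+z. ennreal (1 / norm z ^ DIM('a)) * indicator {z. r < norm z \<and> norm z < R} z \<partial>(lborel :: 'a::euclidean_space measure))"
proof -
  define q where "q = log 2 (R / r)"
  define k where "k = nat \<lfloor>q\<rfloor>"
  have q: "2 powr q = R / r" using r rR by (simp add: q_def)
  have "1 \<le> q" unfolding q_def using r rR by (subst le_log_iff) (auto simp: field_simps)
  then have k: "1 \<le> k" "real k \<le> q" "q \<le> real k + 1" by (auto simp: k_def le_nat_iff)
  have "2 ^ k = 2 powr real k" by (simp add: powr_realpow)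
  also have "\<dots> \<le> R / r" using k(2) by (simp flip: q)
  finally have kR: "2 ^ k * r \<le> R" using r by (simp add: field_simps)
  have "ln (R / r) = q * ln 2" by (simp flip: q add: ln_powr)
  also have "\<dots> \<le> (2 * real k) * 1"
    using k ln_2_less_1 by (intro mult_mono) auto
  finally have "ln (R / r) \<le> 4 / unit_ball_vol DIM('a) * (real k * unit_ball_vol DIM('a) / 2)"
    by (simp add: less_imp_neq[OF unit_ball_vol_pos, symmetric])
  then have "ennreal (ln (R / r)) \<le> ennreal (4 / unit_ball_vol DIM('a)) * ennreal (real k * unit_ball_vol DIM('a) / 2)"
    by (simp add: ennreal_mult'[symmetric] ennreal_leI del: times_divide_eq_right times_divide_eq_left)
  also have "\<dots> \<le> ennreal (4 / unit_ball_vol DIM('a)) *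
    (\<integral>\<^sup>+z. ennreal (1 / norm z ^ DIM('a)) * indicator {z. r < norm z \<and> norm z < R} z \<partial>(lborel :: 'a::euclidean_space measure))"
    by (intro mult_left_mono annulus_weight_lower_bound r kR) simp
  finally show ?thesis .
qed

text \<open>
  For decreasing \<open>v\<close> and \<open>s = |x-y|\<close> the weight \<open>s v(2s)\<close> is at most the integral of \<open>v\<close> over
  \<open>(s, 2s)\<close>. Exchanging the integrals replaces the radial weight by integrals of \<open>F\<close> over balls about
  \<open>x\<close>. The form \<open>s v(2s)\<close>, rather than an antiderivative of \<open>v\<close>, treats all dimensions alike.
\<close>

lemma nn_integral_ball_layer_cake:
  fixes F :: "'a::euclidean_space \<Rightarrow> ennreal" and v :: "real \<Rightarrow> real"
  assumes [measurable]: "F \<in> borel_measurable borel" "v \<in> borel_measurable borel"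
    and v: "\<And>s t. 0 < s \<Longrightarrow> s \<le> t \<Longrightarrow> v t \<le> v s" "\<And>t. 0 < t \<Longrightarrow> 0 \<le> v t"
  shows "(\<integral>\<^sup>+y. ennreal (norm (x - y) * v (2 * norm (x - y))) * F y * indicator (ball x \<rho>) y \<partial>lborel)
    \<le> (\<integral>\<^sup>+t. ennreal (v t) * (\<integral>\<^sup>+y. F y * indicator (ball x t) y \<partial>lborel) * indicator {0<..<2 * \<rho>} t \<partial>lborel)"
proof -
  define \<Phi> where "\<Phi> t y = ennreal (v t) * F y * indicator {t. norm (x - y) < t \<and> t < 2 * \<rho>} t" for t y
  have mind: "(\<lambda>p::real \<times> 'a. indicator {t. norm (x - snd p) < t \<and> t < 2 * \<rho>} (fst p) :: ennreal) \<in> borel_measurable (lborel \<Otimes>\<^sub>M lborel)"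
  proof -
    have "(\<lambda>p::real \<times> 'a. if norm (x - snd p) < fst p \<and> fst p < 2 * \<rho> then 1 else 0 :: ennreal) \<in> borel_measurable (lborel \<Otimes>\<^sub>M lborel)"
      by measurable
    then show ?thesis by (simp add: indicator_def of_bool_def)
  qed
  have \<Phi>m: "case_prod \<Phi> \<in> borel_measurable (lborel \<Otimes>\<^sub>M lborel)"
    unfolding \<Phi>_def case_prod_unfold by (intro borel_measurable_times_ennreal mind) measurable
  have "ennreal (norm (x - y) * v (2 * norm (x - y))) * F y * indicator (ball x \<rho>) y \<le> (\<integral>\<^sup>+t. \<Phi> t y \<partial>lborel)" for y
  proof (cases "y \<in> ball x \<rho> \<and> y \<noteq> x")
    case True
    define s where "s = norm (x - y)"
    have s: "0 < s" "s < \<rho>" using True by (auto simp: s_def dist_norm)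
    have "ennreal (s * v (2 * s)) * F y = (\<integral>\<^sup>+t. ennreal (v (2 * s)) * F y * indicator {s<..<2 * s} t \<partial>lborel)"
      using s v(2)[of "2 * s"] by (subst nn_integral_cmult_indicator) (auto simp: ennreal_mult' mult_ac)
    also have "\<dots> \<le> (\<integral>\<^sup>+t. \<Phi> t y \<partial>lborel)"
    proof (rule nn_integral_mono)
      fix t
      show "ennreal (v (2 * s)) * F y * indicator {s<..<2 * s} t \<le> \<Phi> t y"
        using s v(1)[of t "2 * s"]
        by (auto simp: \<Phi>_def s_def[symmetric] indicator_def intro!: mult_right_mono ennreal_leI)
    qed
    finally show ?thesis using True by (simp add: s_def)
  qed auto
  then have "(\<integral>\<^sup>+y. ennreal (norm (x - y) * v (2 * norm (x - y))) * F y * indicator (ball x \<rho>) y \<partial>lborel)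
      \<le> (\<integral>\<^sup>+y. (\<integral>\<^sup>+t. \<Phi> t y \<partial>lborel) \<partial>lborel)"
    by (intro nn_integral_mono)
  also have "\<dots> = (\<integral>\<^sup>+t. (\<integral>\<^sup>+y. \<Phi> t y \<partial>lborel) \<partial>lborel)"
    by (rule lborel_pair.Fubini'[OF \<Phi>m])
  also have "\<dots> \<le> (\<integral>\<^sup>+t. ennreal (v t) * (\<integral>\<^sup>+y. F y * indicator (ball x t) y \<partial>lborel) * indicator {0<..<2 * \<rho>} t \<partial>lborel)"
  proof (rule nn_integral_mono)
    fix t :: real
    have "(\<integral>\<^sup>+y. \<Phi> t y \<partial>lborel) \<le> (\<integral>\<^sup>+y. (ennreal (v t) * indicator {0<..<2 * \<rho>} t) * (F y * indicator (ball x t) y) \<partial>lborel)"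
    proof (rule nn_integral_mono)
      fix y
      show "\<Phi> t y \<le> (ennreal (v t) * indicator {0<..<2 * \<rho>} t) * (F y * indicator (ball x t) y)"
      proof (cases "norm (x - y) < t \<and> t < 2 * \<rho>")
        case True
        moreover have "0 < t" using True norm_ge_zero[of "x - y"] by linarith
        ultimately show ?thesis by (simp add: \<Phi>_def dist_norm)
      qed (auto simp: \<Phi>_def)
    qed
    also have "\<dots> = (ennreal (v t) * indicator {0<..<2 * \<rho>} t) * (\<integral>\<^sup>+y. F y * indicator (ball x t) y \<partial>lborel)"
      by (rule nn_integral_cmult) (auto intro!: borel_measurable_times_ennreal borel_measurable_indicator)
    finally show "(\<integral>\<^sup>+y. \<Phi> t y \<partial>lborel) \<le>
        ennreal (v t) * (\<integral>\<^sup>+y. F y * indicator (ball x t) y \<partial>lborel) * indicator {0<..<2 * \<rho>} t"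
      by (simp add: mult_ac)
  qed
  finally show ?thesis .
qed

text \<open>
  On a ball \<open>(ln |y|)\<^sup>2\<close> is at most a constant times \<open>|y|\<^bsup>-1/2\<^esup>\<close> plus a constant, and \<open>|y|\<^bsup>-1/2\<^esup>\<close> is locally
  integrable in every dimension: the layer-cake bound with \<open>v(t) = t\<^bsup>-3/2\<^esup>\<close> reduces this to the
  integrability of \<open>t\<^bsup>n-3/2\<^esup>\<close> at \<open>0\<close>.
\<close>

lemma ln_norm_square_integrable_ball:
  fixes R :: real
  assumes R: "0 < R"
  shows "(\<integral>\<^sup>+y. ennreal ((ln (norm y))\<^sup>2) * indicator (ball 0 R) y \<partial>(lborel :: 'a::euclidean_space measure)) < \<infinity>"
proof -
  let ?n = "DIM('a)" and ?v = "unit_ball_vol DIM('a)"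
  define w where "w = (\<lambda>t::real. t powr (- (3/2)))"
  have [measurable]: "w \<in> borel_measurable borel" unfolding w_def by measurable
  have sw: "s * w (2 * s) = 2 powr (-(3/2)) * s powr (-(1/2))" if "0 < s" for s
  proof -
    have "s * w (2 * s) = 2 powr (-(3/2)) * (s powr 1 * s powr (-(3/2)))"
      using that by (simp add: w_def powr_mult)
    then show ?thesis using that by (simp only: powr_add[symmetric]) simp
  qed
  have ln_le: "(ln s)\<^sup>2 \<le> 16 * 2 powr (3/2) * (s * w (2 * s)) + R\<^sup>2" if s: "0 < s" "s < R" for s
  proof (cases "s \<le> 1")
    case True
    have "- ln s = 4 * ln (s powr (-(1/4)))" using s by (simp add: ln_powr)
    also have "\<dots> \<le> 4 * s powr (-(1/4))" using ln_le_minus_one[of "s powr (-(1/4))"] s by simp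
    finally have "(- ln s)\<^sup>2 \<le> (4 * s powr (-(1/4)))\<^sup>2"
      using True s by (intro power_mono) auto
    also have "\<dots> = 16 * s powr (-(1/2))"
      using s by (simp add: power_mult_distrib powr_power)
    also have "\<dots> = 16 * 2 powr (3/2) * (s * w (2 * s))"
    proof -
      have "2 powr (3/2) * 2 powr (-(3/2)) = (1::real)" by (simp only: powr_add[symmetric]) simp
      then have "16 * 2 powr (3/2) * (2 powr (-(3/2)) * u) = 16 * u" for u :: real
        by (metis mult.assoc mult_1)
      then show ?thesis unfolding sw[OF s(1)] by (rule sym)
    qed
    finally show ?thesis by (simp add: add_increasing2)
  next
    case False
    then have "(ln s)\<^sup>2 \<le> R\<^sup>2" using s ln_le_minus_one[of s] by (intro power_mono) auto
    then show ?thesis using s by (simp add: add_increasing w_def)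
  qed
  let ?c = "ennreal (16 * 2 powr (3/2))"
  have "(\<integral>\<^sup>+y. ennreal ((ln (norm y))\<^sup>2) * indicator (ball 0 R) y \<partial>(lborel :: 'a measure)) \<le>
      (\<integral>\<^sup>+y. ?c * (ennreal (norm (0 - y) * w (2 * norm (0 - y))) * 1 * indicator (ball 0 R) y)
        + ennreal (R\<^sup>2) * indicator (ball 0 R) y \<partial>(lborel :: 'a measure))"
  proof (rule nn_integral_mono)
    fix y :: 'a
    show "ennreal ((ln (norm y))\<^sup>2) * indicator (ball 0 R) y \<le>
       ?c * (ennreal (norm (0 - y) * w (2 * norm (0 - y))) * 1 * indicator (ball 0 R) y) + ennreal (R\<^sup>2) * indicator (ball 0 R) y"
    proof (cases "y \<in> ball 0 R \<and> y \<noteq> 0")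
      case True
      have "ennreal ((ln (norm y))\<^sup>2) \<le> ennreal (16 * 2 powr (3/2) * (norm y * w (2 * norm y)) + R\<^sup>2)"
        using True by (intro ennreal_leI ln_le) auto
      also have "\<dots> = ?c * ennreal (norm y * w (2 * norm y)) + ennreal (R\<^sup>2)"
        by (subst ennreal_plus) (auto simp: w_def ennreal_mult'[symmetric])
      finally show ?thesis using True by simp
    qed auto
  qed
  also have "\<dots> = ?c * (\<integral>\<^sup>+y. ennreal (norm (0 - y) * w (2 * norm (0 - y))) * 1 * indicator (ball 0 R) y \<partial>(lborel :: 'a measure))
      + ennreal (R\<^sup>2) * emeasure lborel (ball (0::'a) R)"
  proof -
    let ?\<Phi> = "\<lambda>y::'a. ennreal (norm (0 - y) * w (2 * norm (0 - y))) * 1 * indicator (ball 0 R) y"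
    have m: "?\<Phi> \<in> borel_measurable lborel"
      by (intro borel_measurable_times_ennreal borel_measurable_indicator) auto
    have "(\<lambda>y::'a. ennreal (R\<^sup>2) * indicator (ball 0 R) y) \<in> borel_measurable lborel"
      by (intro borel_measurable_times_ennreal borel_measurable_indicator) auto
    from nn_integral_add[OF borel_measurable_times_ennreal[OF _ m] this, of "\<lambda>_. ?c"]
    show ?thesis
      by (simp only: nn_integral_cmult[OF m] nn_integral_cmult_indicator borel_measurable_const sets_lborel borel_open open_ball simp_thms)
  qed
  also have "\<dots> < \<infinity>"
  proof -
    have "(\<integral>\<^sup>+y. ennreal (norm (0 - y) * w (2 * norm (0 - y))) * 1 * indicator (ball 0 R) y \<partial>(lborel :: 'a measure))
      \<le> (\<integral>\<^sup>+t. ennreal (w t) * (\<integral>\<^sup>+y. 1 * indicator (ball (0::'a) t) y \<partial>lborel) * indicator {0<..<2 * R} t \<partial>lborel)"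
      by (rule nn_integral_ball_layer_cake) (auto simp: w_def intro: powr_mono2')
    also have "\<dots> \<le> (\<integral>\<^sup>+t. ennreal (?v * (2 * R) ^ (?n - 1)) * (indicator {0..2 * R} t * ennreal (t powr (-(1/2)))) \<partial>lborel)"
    proof (rule nn_integral_mono)
      fix t :: real
      show "ennreal (w t) * (\<integral>\<^sup>+y. 1 * indicator (ball (0::'a) t) y \<partial>lborel) * indicator {0<..<2 * R} t
          \<le> ennreal (?v * (2 * R) ^ (?n - 1)) * (indicator {0..2 * R} t * ennreal (t powr (-(1/2))))"
      proof (cases "t \<in> {0<..<2 * R}")
        case True
        then have t: "0 < t" "t < 2 * R" by auto
        have "w t * (?v * t ^ ?n) = ?v * t ^ (?n - 1) * (t powr 1 * w t)"
          using t by (simp add: power_eq_if)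
        also have "\<dots> = ?v * t ^ (?n - 1) * t powr (-(1/2))"
          unfolding w_def by (simp only: powr_add[symmetric]) simp
        also have "\<dots> \<le> ?v * (2 * R) ^ (?n - 1) * t powr (-(1/2))"
          using t by (intro mult_right_mono mult_left_mono power_mono) (auto simp: less_imp_le)
        finally have "ennreal (w t * (?v * t ^ ?n)) \<le> ennreal (?v * (2 * R) ^ (?n - 1) * t powr (-(1/2)))"
          by (rule ennreal_leI)
        then show ?thesis
          using t R by (simp add: emeasure_ball ennreal_mult' ennreal_mult'' w_def less_imp_le)
      qed simp
    qed
    also have "\<dots> = ennreal (?v * (2 * R) ^ (?n - 1)) * (\<integral>\<^sup>+t. indicator {0..2 * R} t * ennreal (t powr (-(1/2))) \<partial>lborel)"
      by (rule nn_integral_cmult) measurable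
    also have "(\<integral>\<^sup>+t. indicator {0..2 * R} t * ennreal (t powr (-(1/2))) \<partial>lborel) = ennreal ((2 * R) powr (-(1/2) + 1) / (-(1/2) + 1))"
    proof -
      have "(\<integral>\<^sup>+t. ennreal (indicator {0..2 * R} t * (t powr (-(1/2)))) \<partial>lborel) = ennreal ((2 * R) powr (-(1/2) + 1) / (-(1/2) + 1))"
      proof (rule nn_integral_has_integral_lebesgue)
        show "((\<lambda>t. t powr (-(1/2))) has_integral ((2 * R) powr (-(1/2) + 1) / (-(1/2) + 1))) {0..2 * R}"
          using R by (intro has_integral_powr_from_0) auto
      qed simp
      then show ?thesis by (simp add: ennreal_mult' ennreal_indicator)
    qed
    finally have "(\<integral>\<^sup>+y. ennreal (norm (0 - y) * w (2 * norm (0 - y))) * 1 * indicator (ball 0 R) y \<partial>(lborel :: 'a measure)) < \<infinity>"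
      by (rule le_less_trans) (simp add: ennreal_mult_less_top)
    then show ?thesis using R by (simp add: emeasure_ball ennreal_mult_less_top)
  qed
  finally show ?thesis .
qed

section \<open>The radial Hardy operators and the maximal function\<close>

lemma measure_ball_lebesgue:
  "0 \<le> r \<Longrightarrow> measure lebesgue (ball (x::'a::euclidean_space) r) = unit_ball_vol DIM('a) * r ^ DIM('a)"
  by (simp add: content_ball)

text \<open>
  Passes from the integrals that define the averaging operators to extended nonnegative integrals
  over the Borel-Lebesgue measure, where Tonelli's theorem applies.
\<close>

lemma ennreal_set_integral:
  fixes h :: "'a::euclidean_space \<Rightarrow> real"
  assumes [measurable]: "h \<in> borel_measurable borel" "S \<in> sets borel"
    and h: "\<And>y. y \<in> S \<Longrightarrow> 0 \<le> h y"
    and fin: "(\<integral>\<^sup>+y. ennreal (h y) * indicator S y \<partial>lborel) < \<infinity>"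
  shows "ennreal (LINT y:S|lebesgue. h y) = (\<integral>\<^sup>+y. ennreal (h y) * indicator S y \<partial>lborel)"
proof -
  have eq: "ennreal (indicator S y *\<^sub>R h y) = ennreal (h y) * indicator S y" for y
    by (simp add: indicator_def)
  have "(\<lambda>y. indicator S y *\<^sub>R h y) \<in> borel_measurable borel" by measurable
  then have "(\<lambda>y. indicator S y *\<^sub>R h y) \<in> borel_measurable lebesgue"
    by (simp add: measurable_completion)
  then have "(LINT y:S|lebesgue. h y) = enn2real (\<integral>\<^sup>+y. ennreal (indicator S y *\<^sub>R h y) \<partial>lebesgue)"
    unfolding set_lebesgue_integral_def
    by (rule integral_eq_nn_integral) (use h in \<open>auto simp: indicator_def\<close>)
  also have "\<dots> = enn2real (\<integral>\<^sup>+y. ennreal (h y) * indicator S y \<partial>lborel)"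
    by (simp only: eq nn_integral_completion)
  finally show ?thesis using fin by simp
qed

lemma nn_integral_bounded_on_ball:
  fixes h :: "'a::euclidean_space \<Rightarrow> real"
  assumes "\<And>y. y \<in> S \<Longrightarrow> y \<in> ball x r \<and> h y \<le> M \<or> h y = 0" and "0 \<le> M" "0 \<le> r"
  shows "(\<integral>\<^sup>+y. ennreal (h y) * indicator S y \<partial>lborel) \<le> ennreal (M * (unit_ball_vol DIM('a) * r ^ DIM('a)))"
proof -
  have "(\<integral>\<^sup>+y. ennreal (h y) * indicator S y \<partial>lborel) \<le> (\<integral>\<^sup>+y. ennreal M * indicator (ball x r) y \<partial>lborel)"
    using assms(1) by (intro nn_integral_mono) (force simp: indicator_def intro: ennreal_leI)
  also have "\<dots> = ennreal M * emeasure lborel (ball x r)"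
    by (rule nn_integral_cmult_indicator) simp
  finally show ?thesis using assms(2,3) by (simp add: emeasure_ball ennreal_mult')
qed

lemma borel_measurable_radial_set_integral:
  fixes h :: "'a::euclidean_space \<Rightarrow> real" and P :: "real \<Rightarrow> real \<Rightarrow> bool"
  assumes [measurable]: "h \<in> borel_measurable borel"
    and P[measurable]: "Measurable.pred (borel \<Otimes>\<^sub>M borel) (\<lambda>(s, t). P s t)"
  shows "(\<lambda>x::'a. LINT y:{y. P (norm x) (norm y)}|lebesgue. h y) \<in> borel_measurable borel"
proof -
  have P': "Measurable.pred (borel \<Otimes>\<^sub>M borel) (\<lambda>p::'a \<times> 'a. P (norm (fst p)) (norm (snd p)))"
    using measurable_compose[OF _ P, of "\<lambda>p::'a \<times> 'a. (norm (fst p), norm (snd p))" "borel \<Otimes>\<^sub>M borel"] by simp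
  have [measurable]: "Measurable.pred borel (\<lambda>y::'a. P (norm x) (norm y))" for x :: 'a
    using measurable_compose[OF _ P', of "\<lambda>y. (x, y)" borel] by simp
  have m: "(\<lambda>y. indicator {y. P (norm x) (norm y)} y *\<^sub>R h y) \<in> borel_measurable lborel" for x :: 'a
    by measurable
  have "(\<lambda>x::'a. LINT y|lborel. (if P (norm x) (norm y) then h y else 0)) \<in> borel_measurable borel"
  proof (rule lborel.borel_measurable_lebesgue_integral)
    show "(\<lambda>(x::'a, y). if P (norm x) (norm y) then h y else 0) \<in> borel_measurable (borel \<Otimes>\<^sub>M lborel)"
      using P' by (simp add: case_prod_unfold)
  qed
  moreover have "(LINT y:{y. P (norm x) (norm y)}|lebesgue. h y) = (LINT y|lborel. (if P (norm x) (norm y) then h y else 0))" for x :: 'a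
    unfolding set_lebesgue_integral_def integral_completion[OF m]
    by (intro Bochner_Integration.integral_cong) auto
  ultimately show ?thesis by simp
qed

lemma radial_hardy_eq_nn_integral:
  fixes h :: "'a::euclidean_space \<Rightarrow> real"
  assumes [measurable]: "h \<in> borel_measurable borel" and h: "\<And>y. 0 \<le> h y" "\<And>y. h y \<le> M" and x: "x \<noteq> 0"
  shows "(\<integral>\<^sup>+y. ennreal (h y) * indicator {y. norm y < norm x} y \<partial>lborel) =
      ennreal (unit_ball_vol DIM('a) * norm x ^ DIM('a)) * ennreal (radial_hardy h x)"
    and "0 \<le> radial_hardy h x" "radial_hardy h x \<le> M"
proof -
  let ?v = "unit_ball_vol DIM('a)"
  let ?S = "{y. norm y < norm x}"
  let ?J = "LINT y:?S|lebesgue. h y"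
  have v: "0 < ?v" by simp
  have M: "0 \<le> M" using h[of 0] by linarith
  have le: "(\<integral>\<^sup>+y. ennreal (h y) * indicator ?S y \<partial>lborel) \<le> ennreal (M * (?v * norm x ^ DIM('a)))"
    by (rule nn_integral_bounded_on_ball[where x=0]) (use h M in \<open>auto simp: dist_norm\<close>)
  have J: "ennreal ?J = (\<integral>\<^sup>+y. ennreal (h y) * indicator ?S y \<partial>lborel)"
    by (rule ennreal_set_integral) (use h le in \<open>auto intro: le_less_trans\<close>)
  have J0: "0 \<le> ?J"
    unfolding set_lebesgue_integral_def by (intro integral_nonneg_AE AE_I2) (simp add: h)
  have JM: "?J \<le> M * (?v * norm x ^ DIM('a))"
    using le M v unfolding J[symmetric] by (subst (asm) ennreal_le_iff) auto
  have rh: "radial_hardy h x = ?J / (?v * norm x ^ DIM('a))"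
    by (simp add: radial_hardy_def content_ball)
  have pos: "0 < ?v * norm x ^ DIM('a)" using x by simp
  show "0 \<le> radial_hardy h x" unfolding rh using J0 pos by simp
  show "radial_hardy h x \<le> M" unfolding rh using JM pos by (subst pos_divide_le_eq) auto
  have nz: "?v * norm x ^ DIM('a) \<noteq> 0" using pos by linarith
  have "?J = (?v * norm x ^ DIM('a)) * radial_hardy h x"
    unfolding rh by (simp only: times_divide_eq_right nonzero_mult_div_cancel_left[OF nz])
  then show "(\<integral>\<^sup>+y. ennreal (h y) * indicator ?S y \<partial>lborel) =
      ennreal (?v * norm x ^ DIM('a)) * ennreal (radial_hardy h x)"
    unfolding J[symmetric] using pos by (metis ennreal_mult' less_imp_le)
qed

lemma radial_hardy_adj_eq_nn_integral:
  fixes h :: "'a::euclidean_space \<Rightarrow> real" and x :: 'a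
  assumes [measurable]: "h \<in> borel_measurable borel" and h: "\<And>y. 0 \<le> h y"
    "\<And>y. norm x < norm y \<Longrightarrow> h y \<le> M" "\<And>y. R \<le> norm y \<Longrightarrow> h y = 0"
    and x: "x \<noteq> 0" and "0 \<le> M" "0 \<le> R"
  shows "(\<integral>\<^sup>+y. ennreal (h y / norm y ^ DIM('a)) * indicator {y. norm x < norm y} y \<partial>lborel) =
      ennreal (unit_ball_vol DIM('a)) * ennreal (radial_hardy_adj h x)"
    and "0 \<le> radial_hardy_adj h x" "radial_hardy_adj h x \<le> M / norm x ^ DIM('a) * R ^ DIM('a)"
proof -
  let ?v = "unit_ball_vol DIM('a)"
  let ?S = "{y::'a. norm x < norm y}"
  let ?J = "LINT y:?S|lebesgue. h y / norm y ^ DIM('a)"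
  have v: "0 < ?v" by simp
  have le: "(\<integral>\<^sup>+y. ennreal (h y / norm y ^ DIM('a)) * indicator ?S y \<partial>lborel) \<le> ennreal (M / norm x ^ DIM('a) * (?v * R ^ DIM('a)))"
  proof (rule nn_integral_bounded_on_ball[where x=0])
    fix y assume "y \<in> ?S"
    then have y: "norm x < norm y" by simp
    show "y \<in> ball 0 R \<and> h y / norm y ^ DIM('a) \<le> M / norm x ^ DIM('a) \<or> h y / norm y ^ DIM('a) = 0"
    proof (cases "R \<le> norm y")
      case False
      have "h y / norm y ^ DIM('a) \<le> M / norm x ^ DIM('a)"
        using h(2)[OF y] y x assms(6) by (intro frac_le power_mono) auto
      with False show ?thesis by simp
    qed (simp add: h)
  qed (use assms in auto)
  have J: "ennreal ?J = (\<integral>\<^sup>+y. ennreal (h y / norm y ^ DIM('a)) * indicator ?S y \<partial>lborel)"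
    by (rule ennreal_set_integral) (use h le in \<open>auto intro: le_less_trans\<close>)
  have J0: "0 \<le> ?J"
    unfolding set_lebesgue_integral_def by (intro integral_nonneg_AE AE_I2) (simp add: h)
  have JM: "?J \<le> M / norm x ^ DIM('a) * (?v * R ^ DIM('a))"
    using le assms v unfolding J[symmetric] by (subst (asm) ennreal_le_iff) auto
  have rh: "radial_hardy_adj h x = ?J / ?v"
    by (simp add: radial_hardy_adj_def content_ball divide_inverse mult.commute)
  show "0 \<le> radial_hardy_adj h x" unfolding rh using J0 v by simp
  show "radial_hardy_adj h x \<le> M / norm x ^ DIM('a) * R ^ DIM('a)"
    unfolding rh using JM v by (subst pos_divide_le_eq) (auto simp: mult_ac)
  have nz: "?v \<noteq> 0" using v by linarith
  have "?J = ?v * radial_hardy_adj h x"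
    unfolding rh by (simp only: times_divide_eq_right nonzero_mult_div_cancel_left[OF nz])
  then show "(\<integral>\<^sup>+y. ennreal (h y / norm y ^ DIM('a)) * indicator ?S y \<partial>lborel) =
      ennreal ?v * ennreal (radial_hardy_adj h x)"
    unfolding J[symmetric] using v by (metis ennreal_mult' less_imp_le)
qed

lemma radial_hardy_measurable:
  fixes h :: "'a::euclidean_space \<Rightarrow> real"
  assumes [measurable]: "h \<in> borel_measurable borel"
  shows "radial_hardy h \<in> borel_measurable borel"
proof -
  have [measurable]: "(\<lambda>x::'a. LINT y:{y. norm y < norm x}|lebesgue. h y) \<in> borel_measurable borel"
    by (rule borel_measurable_radial_set_integral[where P = "\<lambda>s t. t < s"]) measurable
  show ?thesis unfolding radial_hardy_def[abs_def] by measurable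
qed

lemma radial_hardy_adj_measurable:
  fixes h :: "'a::euclidean_space \<Rightarrow> real"
  assumes [measurable]: "h \<in> borel_measurable borel"
  shows "radial_hardy_adj h \<in> borel_measurable borel"
proof -
  have [measurable]: "(\<lambda>x::'a. LINT y:{y. norm x < norm y}|lebesgue. h y /\<^sub>R norm y ^ DIM('a)) \<in> borel_measurable borel"
    by (rule borel_measurable_radial_set_integral[where P = "\<lambda>s t. s < t"]) measurable
  show ?thesis unfolding radial_hardy_adj_def[abs_def] by measurable
qed

lemma indicator_annulus_measurable:
  "(\<lambda>p::'a::euclidean_space \<times> 'a. indicator {z. norm (snd p) < norm z \<and> norm z < r} (fst p) :: ennreal)
     \<in> borel_measurable (lborel \<Otimes>\<^sub>M lborel)"
  "(\<lambda>p::'a::euclidean_space \<times> 'a. indicator {z. r < norm z \<and> norm z < norm (snd p)} (fst p) :: ennreal)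
     \<in> borel_measurable (lborel \<Otimes>\<^sub>M lborel)"
proof -
  have "(\<lambda>p::'a \<times> 'a. if norm (snd p) < norm (fst p) \<and> norm (fst p) < r then 1 else 0 :: ennreal) \<in> borel_measurable (lborel \<Otimes>\<^sub>M lborel)"
    "(\<lambda>p::'a \<times> 'a. if r < norm (fst p) \<and> norm (fst p) < norm (snd p) then 1 else 0 :: ennreal) \<in> borel_measurable (lborel \<Otimes>\<^sub>M lborel)"
    by measurable
  then show "(\<lambda>p::'a \<times> 'a. indicator {z. norm (snd p) < norm z \<and> norm z < r} (fst p) :: ennreal) \<in> borel_measurable (lborel \<Otimes>\<^sub>M lborel)"
    "(\<lambda>p::'a \<times> 'a. indicator {z. r < norm z \<and> norm z < norm (snd p)} (fst p) :: ennreal) \<in> borel_measurable (lborel \<Otimes>\<^sub>M lborel)"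
    by (simp_all add: indicator_def of_bool_def)
qed

lemma nn_integral_swap_cmult:
  fixes \<Psi> :: "'a::euclidean_space \<Rightarrow> 'b::euclidean_space \<Rightarrow> ennreal"
  assumes \<Psi>: "case_prod \<Psi> \<in> borel_measurable (lborel \<Otimes>\<^sub>M lborel)"
  shows "(\<integral>\<^sup>+y. c * (\<integral>\<^sup>+z. \<Psi> z y \<partial>lborel) \<partial>lborel) = c * (\<integral>\<^sup>+z. (\<integral>\<^sup>+y. \<Psi> z y \<partial>lborel) \<partial>lborel)"
proof -
  have "(\<lambda>(y, z). \<Psi> z y) \<in> borel_measurable (lborel \<Otimes>\<^sub>M lborel)"
    using measurable_pair_swap[OF \<Psi>] by simp
  then have "(\<lambda>y. \<integral>\<^sup>+z. \<Psi> z y \<partial>lborel) \<in> borel_measurable lborel"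
    by (rule lborel.borel_measurable_nn_integral)
  then show ?thesis
    by (subst nn_integral_cmult) (auto simp: lborel_pair.Fubini'[OF \<Psi>])
qed

text \<open>
  Replacing the logarithm by the weight \<open>|z|\<^sup>-\<^sup>n\<close> of the annulus \<open>|y| < |z| < |x|\<close> and integrating first
  over \<open>y\<close> produces \<open>\<omega>\<^sub>n\<close> times the Hardy average of \<open>F\<close> at \<open>z\<close>, integrated over \<open>|z| < |x|\<close>.
\<close>

lemma ln_weight_le_radial_hardy_square:
  fixes F :: "'a::euclidean_space \<Rightarrow> real"
  assumes [measurable]: "F \<in> borel_measurable borel" and F: "\<And>y. 0 \<le> F y" "\<And>y. F y \<le> M" and x: "x \<noteq> 0"
  shows "(\<integral>\<^sup>+y. ennreal (ln (norm x / norm y) * F y) * indicator {y. 0 < norm y \<and> 2 * norm y \<le> norm x} y \<partial>lborel)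
      \<le> ennreal (4 * unit_ball_vol DIM('a) * norm x ^ DIM('a) * radial_hardy (radial_hardy F) x)"
proof -
  let ?v = "unit_ball_vol DIM('a)" and ?n = "DIM('a)"
  define \<Psi> where "\<Psi> z y = ennreal (1 / norm z ^ ?n) * ennreal (F y) * indicator {z. norm y < norm z \<and> norm z < norm x} z" for z y :: 'a
  have \<Psi>m: "case_prod \<Psi> \<in> borel_measurable (lborel \<Otimes>\<^sub>M lborel)"
    unfolding \<Psi>_def case_prod_unfold by (intro borel_measurable_times_ennreal indicator_annulus_measurable) measurable
  have PF0: "0 \<le> radial_hardy F z" and PFM: "radial_hardy F z \<le> M" for z
  proof -
    have "0 \<le> radial_hardy F z \<and> radial_hardy F z \<le> M"
    proof (cases "z = 0")
      case True
      then have "radial_hardy F z = 0" by (simp add: radial_hardy_def)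
      then show ?thesis using F[of 0] by simp
    next
      case False
      from radial_hardy_eq_nn_integral(2,3)[OF assms(1) F False] show ?thesis by simp
    qed
    then show "0 \<le> radial_hardy F z" "radial_hardy F z \<le> M" by auto
  qed
  have inner: "ennreal (ln (norm x / norm y) * F y) * indicator {y. 0 < norm y \<and> 2 * norm y \<le> norm x} y
      \<le> ennreal (4 / ?v) * (\<integral>\<^sup>+z. \<Psi> z y \<partial>lborel)" for y
  proof (cases "0 < norm y \<and> 2 * norm y \<le> norm x")
    case True
    have "ennreal (ln (norm x / norm y) * F y) = ennreal (F y) * ennreal (ln (norm x / norm y))"
      using F by (simp add: ennreal_mult'[symmetric] mult.commute)
    also have "\<dots> \<le> ennreal (F y) * (ennreal (4 / ?v) *
        (\<integral>\<^sup>+z. ennreal (1 / norm z ^ ?n) * indicator {z::'a. norm y < norm z \<and> norm z < norm x} z \<partial>lborel))"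
      using True by (intro mult_left_mono ln_le_annulus_weight) auto
    also have "\<dots> = ennreal (4 / ?v) * (\<integral>\<^sup>+z. ennreal (F y) * (ennreal (1 / norm z ^ ?n) * indicator {z::'a. norm y < norm z \<and> norm z < norm x} z) \<partial>lborel)"
      by (subst nn_integral_cmult) (measurable, simp add: mult_ac)
    finally show ?thesis using True by (simp add: \<Psi>_def mult_ac)
  qed auto
  have outer: "(\<integral>\<^sup>+y. \<Psi> z y \<partial>lborel) = ennreal ?v * (ennreal (radial_hardy F z) * indicator {z. norm z < norm x} z)" for z
  proof (cases "z \<noteq> 0 \<and> norm z < norm x")
    case True
    then have pos: "0 < norm z ^ ?n" by simp
    have "(\<integral>\<^sup>+y. \<Psi> z y \<partial>lborel) = (\<integral>\<^sup>+y. ennreal (1 / norm z ^ ?n) * (ennreal (F y) * indicator {y. norm y < norm z} y) \<partial>lborel)"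
      using True by (intro nn_integral_cong) (auto simp: \<Psi>_def indicator_def)
    also have "\<dots> = ennreal (1 / norm z ^ ?n) * (ennreal (?v * norm z ^ ?n) * ennreal (radial_hardy F z))"
      using True by (subst nn_integral_cmult) (measurable, simp add: radial_hardy_eq_nn_integral(1)[OF assms(1) F])
    also have "\<dots> = ennreal (1 / norm z ^ ?n * (?v * norm z ^ ?n)) * ennreal (radial_hardy F z)"
    proof -
      have "ennreal (1 / norm z ^ ?n * (?v * norm z ^ ?n)) = ennreal (1 / norm z ^ ?n) * ennreal (?v * norm z ^ ?n)"
        using pos by (intro ennreal_mult') simp
      then show ?thesis by (simp only: mult.assoc)
    qed
    also have "1 / norm z ^ ?n * (?v * norm z ^ ?n) = ?v" using True by simp
    finally show ?thesis using True by simp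
  next
    case False
    have "radial_hardy F 0 = 0" by (simp add: radial_hardy_def)
    moreover have "\<Psi> z y = 0" for y using False by (auto simp: \<Psi>_def)
    ultimately show ?thesis using False by (cases "z = 0") auto
  qed
  have "(\<integral>\<^sup>+y. ennreal (ln (norm x / norm y) * F y) * indicator {y. 0 < norm y \<and> 2 * norm y \<le> norm x} y \<partial>lborel)
      \<le> (\<integral>\<^sup>+y. ennreal (4 / ?v) * (\<integral>\<^sup>+z. \<Psi> z y \<partial>lborel) \<partial>lborel)"
    by (intro nn_integral_mono inner)
  also have "\<dots> = ennreal (4 / ?v) * (\<integral>\<^sup>+z. (\<integral>\<^sup>+y. \<Psi> z y \<partial>lborel) \<partial>lborel)"
    by (rule nn_integral_swap_cmult[OF \<Psi>m])
  also have "\<dots> = ennreal (4 / ?v) * (ennreal ?v * (\<integral>\<^sup>+z. ennreal (radial_hardy F z) * indicator {z. norm z < norm x} z \<partial>lborel))"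
  proof -
    note [measurable] = radial_hardy_measurable[OF assms(1)]
    have "(\<lambda>z. ennreal (radial_hardy F z) * indicator {z. norm z < norm x} z) \<in> borel_measurable lborel"
      by measurable
    then show ?thesis by (simp only: outer nn_integral_cmult)
  qed
  also have "\<dots> = ennreal (4 / ?v) * (ennreal ?v * (ennreal (?v * norm x ^ ?n) * ennreal (radial_hardy (radial_hardy F) x)))"
    by (subst radial_hardy_eq_nn_integral(1)[OF radial_hardy_measurable[OF assms(1)] PF0 PFM x]) simp
  also have "\<dots> = ennreal (4 / ?v * (?v * (?v * norm x ^ ?n * radial_hardy (radial_hardy F) x)))"
  proof -
    have "0 \<le> 4 / ?v" "0 \<le> ?v" "0 \<le> ?v * norm x ^ ?n" by (auto simp: less_imp_le)
    from this[THEN ennreal_mult'] show ?thesis by (simp only:)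
  qed
  also have "4 / ?v * (?v * (?v * norm x ^ ?n * radial_hardy (radial_hardy F) x)) = 4 * ?v * norm x ^ ?n * radial_hardy (radial_hardy F) x"
    by (simp add: less_imp_neq[OF unit_ball_vol_pos, symmetric])
  finally show ?thesis .
qed

text \<open>
  The same exchange of integrals over \<open>|x| < |z| < |y|\<close>. The function \<open>radial_hardy_adj F\<close> can be
  unbounded near the origin, but beyond \<open>|x|\<close> it is bounded, and it has bounded support; this
  makes the outer integral converge.
\<close>

lemma ln_weight_le_radial_hardy_adj_square:
  fixes F :: "'a::euclidean_space \<Rightarrow> real"
  assumes [measurable]: "F \<in> borel_measurable borel" and F: "\<And>y. 0 \<le> F y" "\<And>y. F y \<le> M"
    "\<And>y. R \<le> norm y \<Longrightarrow> F y = 0" and R: "0 \<le> R" and x: "x \<noteq> 0"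
  shows "(\<integral>\<^sup>+y. ennreal (ln (norm y / norm x) / norm y ^ DIM('a) * F y) * indicator {y. 2 * norm x \<le> norm y} y \<partial>lborel)
      \<le> ennreal (4 * unit_ball_vol DIM('a) * radial_hardy_adj (radial_hardy_adj F) x)"
    and "0 \<le> radial_hardy_adj (radial_hardy_adj F) x"
proof -
  let ?v = "unit_ball_vol DIM('a)" and ?n = "DIM('a)"
  have M: "0 \<le> M" using F(1,2)[of 0] by linarith
  define \<Psi> where "\<Psi> z y = ennreal (1 / norm z ^ ?n) * ennreal (F y / norm y ^ ?n) * indicator {z. norm x < norm z \<and> norm z < norm y} z" for z y :: 'a
  have \<Psi>m: "case_prod \<Psi> \<in> borel_measurable (lborel \<Otimes>\<^sub>M lborel)"
    unfolding \<Psi>_def case_prod_unfold by (intro borel_measurable_times_ennreal indicator_annulus_measurable) measurable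
  note adj = radial_hardy_adj_eq_nn_integral[OF assms(1) F(1) F(2) F(3) _ M R]
  have PF0: "0 \<le> radial_hardy_adj F z" for z
    unfolding radial_hardy_adj_def set_lebesgue_integral_def
    by (intro scaleR_nonneg_nonneg integral_nonneg_AE AE_I2) (auto simp: F)
  have PFM: "radial_hardy_adj F z \<le> M / norm x ^ ?n * R ^ ?n" if "norm x < norm z" for z
  proof -
    have z: "z \<noteq> 0" using that x by auto
    have "M / norm z ^ ?n * R ^ ?n \<le> M / norm x ^ ?n * R ^ ?n"
      using that x z M R by (intro mult_right_mono divide_left_mono power_mono mult_pos_pos zero_less_power) auto
    with adj(3)[OF _ z] show ?thesis by simp
  qed
  have PFR: "radial_hardy_adj F z = 0" if "R \<le> norm z" for z
  proof -
    have "indicator {y. norm z < norm y} y *\<^sub>R (F y /\<^sub>R norm y ^ ?n) = 0" for y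
      using F(3)[of y] that by (auto simp: indicator_def)
    then show ?thesis
      unfolding radial_hardy_adj_def set_lebesgue_integral_def by (simp only: integral_zero scaleR_zero_right)
  qed
  note adj2 = radial_hardy_adj_eq_nn_integral[OF radial_hardy_adj_measurable[OF assms(1)] PF0 PFM PFR x _ R]
  have B: "0 \<le> M / norm x ^ ?n * R ^ ?n" using M R by simp
  show nonneg: "0 \<le> radial_hardy_adj (radial_hardy_adj F) x" by (rule adj2(2)) (use B in auto)
  have inner: "ennreal (ln (norm y / norm x) / norm y ^ ?n * F y) * indicator {y. 2 * norm x \<le> norm y} y
      \<le> ennreal (4 / ?v) * (\<integral>\<^sup>+z. \<Psi> z y \<partial>lborel)" for y
  proof (cases "2 * norm x \<le> norm y")
    case True
    have "ennreal (ln (norm y / norm x) / norm y ^ ?n * F y) = ennreal (F y / norm y ^ ?n) * ennreal (ln (norm y / norm x))"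
      using F(1)[of y] by (subst ennreal_mult'[symmetric]) (auto simp: mult_ac)
    also have "\<dots> \<le> ennreal (F y / norm y ^ ?n) * (ennreal (4 / ?v) *
        (\<integral>\<^sup>+z. ennreal (1 / norm z ^ ?n) * indicator {z::'a. norm x < norm z \<and> norm z < norm y} z \<partial>lborel))"
      using True x by (intro mult_left_mono ln_le_annulus_weight) auto
    also have "\<dots> = ennreal (4 / ?v) * (\<integral>\<^sup>+z. ennreal (F y / norm y ^ ?n) * (ennreal (1 / norm z ^ ?n) * indicator {z::'a. norm x < norm z \<and> norm z < norm y} z) \<partial>lborel)"
      by (subst nn_integral_cmult) (measurable, simp add: mult_ac)
    finally show ?thesis using True by (simp add: \<Psi>_def mult_ac)
  qed auto
  have outer: "(\<integral>\<^sup>+y. \<Psi> z y \<partial>lborel) = ennreal ?v * (ennreal (radial_hardy_adj F z / norm z ^ ?n) * indicator {z. norm x < norm z} z)" for z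
  proof (cases "norm x < norm z")
    case True
    then have z: "z \<noteq> 0" by auto
    have "(\<integral>\<^sup>+y. \<Psi> z y \<partial>lborel) = (\<integral>\<^sup>+y. ennreal (1 / norm z ^ ?n) * (ennreal (F y / norm y ^ ?n) * indicator {y. norm z < norm y} y) \<partial>lborel)"
      using True by (intro nn_integral_cong) (auto simp: \<Psi>_def indicator_def)
    also have "\<dots> = ennreal (1 / norm z ^ ?n) * (ennreal ?v * ennreal (radial_hardy_adj F z))"
      using z by (subst nn_integral_cmult) (measurable, simp add: adj(1))
    also have "\<dots> = ennreal ?v * ennreal (radial_hardy_adj F z / norm z ^ ?n)"
      using PF0[of z] by (simp add: ennreal_mult[symmetric])
    finally show ?thesis using True by simp
  next
    case False
    then have "\<Psi> z y = 0" for y by (auto simp: \<Psi>_def)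
    then show ?thesis using False by simp
  qed
  have "(\<integral>\<^sup>+y. ennreal (ln (norm y / norm x) / norm y ^ ?n * F y) * indicator {y. 2 * norm x \<le> norm y} y \<partial>lborel)
      \<le> (\<integral>\<^sup>+y. ennreal (4 / ?v) * (\<integral>\<^sup>+z. \<Psi> z y \<partial>lborel) \<partial>lborel)"
    by (intro nn_integral_mono inner)
  also have "\<dots> = ennreal (4 / ?v) * (\<integral>\<^sup>+z. (\<integral>\<^sup>+y. \<Psi> z y \<partial>lborel) \<partial>lborel)"
    by (rule nn_integral_swap_cmult[OF \<Psi>m])
  also have "\<dots> = ennreal (4 / ?v) * (ennreal ?v * (\<integral>\<^sup>+z. ennreal (radial_hardy_adj F z / norm z ^ ?n) * indicator {z. norm x < norm z} z \<partial>lborel))"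
  proof -
    note [measurable] = radial_hardy_adj_measurable[OF assms(1)]
    have "(\<lambda>z. ennreal (radial_hardy_adj F z / norm z ^ ?n) * indicator {z. norm x < norm z} z) \<in> borel_measurable lborel"
      by measurable
    then show ?thesis by (simp only: outer nn_integral_cmult)
  qed
  also have "\<dots> = ennreal (4 / ?v) * (ennreal ?v * (ennreal ?v * ennreal (radial_hardy_adj (radial_hardy_adj F) x)))"
    by (subst adj2(1)) (use B in auto)
  also have "\<dots> = ennreal (4 / ?v * (?v * (?v * radial_hardy_adj (radial_hardy_adj F) x)))"
  proof -
    have "0 \<le> 4 / ?v" "0 \<le> ?v" by (auto simp: less_imp_le)
    from this[THEN ennreal_mult'] show ?thesis by (simp only:)
  qed
  also have "4 / ?v * (?v * (?v * radial_hardy_adj (radial_hardy_adj F) x)) = 4 * ?v * radial_hardy_adj (radial_hardy_adj F) x"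
    by (simp add: less_imp_neq[OF unit_ball_vol_pos, symmetric])
  finally show "(\<integral>\<^sup>+y. ennreal (ln (norm y / norm x) / norm y ^ ?n * F y) * indicator {y. 2 * norm x \<le> norm y} y \<partial>lborel)
      \<le> ennreal (4 * ?v * radial_hardy_adj (radial_hardy_adj F) x)" .
qed

text \<open>
  Boundedness of \<open>f\<close> makes the set of averages bounded above, so that the real supremum is an upper
  bound.
\<close>

lemma ball_average_le_maximal_function:
  fixes f :: "'a::euclidean_space \<Rightarrow> complex"
  assumes [measurable]: "f \<in> borel_measurable borel" and f: "\<And>y. cmod (f y) \<le> M"
  shows "0 < t \<Longrightarrow> (\<integral>\<^sup>+y. ennreal (cmod (f y)) * indicator (ball x t) y \<partial>lborel)
      \<le> ennreal (unit_ball_vol DIM('a) * t ^ DIM('a) * maximal_function f x)"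
    and "0 \<le> maximal_function f x"
proof -
  let ?v = "unit_ball_vol DIM('a)" and ?n = "DIM('a)"
  let ?J = "\<lambda>t. LINT y:ball x t|lebesgue. norm (f y)"
  have M: "0 \<le> M" using f[of 0] norm_ge_zero order_trans by blast
  have J: "ennreal (?J t) = (\<integral>\<^sup>+y. ennreal (cmod (f y)) * indicator (ball x t) y \<partial>lborel)"
    and J0: "0 \<le> ?J t" and JM: "?J t \<le> M * (?v * t ^ ?n)" if t: "0 < t" for t
  proof -
    have le: "(\<integral>\<^sup>+y. ennreal (cmod (f y)) * indicator (ball x t) y \<partial>lborel) \<le> ennreal (M * (?v * t ^ ?n))"
      by (rule nn_integral_bounded_on_ball[where x=x]) (use f M t in auto)
    show J: "ennreal (?J t) = (\<integral>\<^sup>+y. ennreal (cmod (f y)) * indicator (ball x t) y \<partial>lborel)"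
      by (rule ennreal_set_integral) (use le in \<open>auto intro: le_less_trans\<close>)
    show "0 \<le> ?J t"
      unfolding set_lebesgue_integral_def by (intro integral_nonneg_AE AE_I2) simp
    show "?J t \<le> M * (?v * t ^ ?n)"
      using le M t unfolding J[symmetric] by (subst (asm) ennreal_le_iff) auto
  qed
  have avg: "?J t / measure lebesgue (ball x t) = ?J t / (?v * t ^ ?n)" if "0 < t" for t
    using that by (simp add: content_ball)
  have "bdd_above ((\<lambda>r. ?J r / measure lebesgue (ball x r)) ` {0<..})"
  proof (rule bdd_aboveI2)
    fix r :: real assume "r \<in> {0<..}"
    then have r: "0 < r" by simp
    then have "0 < ?v * r ^ ?n" by simp
    then show "?J r / measure lebesgue (ball x r) \<le> M"
      unfolding avg[OF r] using JM[OF r] by (subst pos_divide_le_eq) auto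
  qed
  then have up: "?J t / (?v * t ^ ?n) \<le> maximal_function f x" if "0 < t" for t
    unfolding maximal_function_def avg[OF that, symmetric] by (rule cSUP_upper[rotated]) (use that in simp)
  show "0 \<le> maximal_function f x"
  proof -
    have "0 \<le> ?J 1 / (?v * 1 ^ ?n)" using J0[of 1] by simp
    with up[of 1] show ?thesis by simp
  qed
  assume t: "0 < t"
  then have pos: "0 < ?v * t ^ ?n" by simp
  have "?J t \<le> ?v * t ^ ?n * maximal_function f x"
    using up[OF t] pos by (simp only: pos_divide_le_eq mult.commute)
  then show "(\<integral>\<^sup>+y. ennreal (cmod (f y)) * indicator (ball x t) y \<partial>lborel)
      \<le> ennreal (?v * t ^ ?n * maximal_function f x)"
    unfolding J[OF t, symmetric] by (rule ennreal_leI)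
qed

text \<open>
  Layer-cake bound with \<open>v(t) = t\<^sup>-\<^sup>n\<close>: the integral of \<open>|f|\<close> over a ball of radius \<open>t\<close> is at most
  \<open>\<omega>\<^sub>n t\<^sup>n Mf(x)\<close>, which leaves a constant integrand on \<open>(0, 2\<rho>)\<close>. Here \<open>|x-y| / |x-y|\<^sup>n\<close> stands for
  \<open>|x-y|\<^bsup>1-n\<^esup>\<close>, also when \<open>n = 1\<close>.
\<close>

lemma weakly_singular_le_maximal_function:
  fixes f :: "'a::euclidean_space \<Rightarrow> complex"
  assumes [measurable]: "f \<in> borel_measurable borel" and f: "\<And>y. cmod (f y) \<le> M" and \<rho>: "0 < \<rho>"
  shows "(\<integral>\<^sup>+y. ennreal (norm (x - y) / norm (x - y) ^ DIM('a) * cmod (f y)) * indicator (ball x \<rho>) y \<partial>lborel)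
      \<le> ennreal (2 ^ DIM('a) * 2 * \<rho> * unit_ball_vol DIM('a) * maximal_function f x)"
proof -
  let ?v = "unit_ball_vol DIM('a)" and ?n = "DIM('a)"
  define w where "w = (\<lambda>t::real. 1 / t ^ ?n)"
  have [measurable]: "w \<in> borel_measurable borel" unfolding w_def by measurable
  note mx = ball_average_le_maximal_function[OF assms(1) f]
  have "(\<integral>\<^sup>+y. ennreal (norm (x - y) / norm (x - y) ^ ?n * cmod (f y)) * indicator (ball x \<rho>) y \<partial>lborel)
      = (\<integral>\<^sup>+y. ennreal (2 ^ ?n) * (ennreal (norm (x - y) * w (2 * norm (x - y))) * ennreal (cmod (f y)) * indicator (ball x \<rho>) y) \<partial>lborel)"
    by (intro nn_integral_cong) (simp add: w_def power_mult_distrib ennreal_mult'[symmetric] mult.assoc[symmetric])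
  also have "\<dots> = ennreal (2 ^ ?n) * (\<integral>\<^sup>+y. ennreal (norm (x - y) * w (2 * norm (x - y))) * ennreal (cmod (f y)) * indicator (ball x \<rho>) y \<partial>lborel)"
    by (rule nn_integral_cmult) (intro borel_measurable_times_ennreal borel_measurable_indicator; simp)
  also have "\<dots> \<le> ennreal (2 ^ ?n) * (\<integral>\<^sup>+t. ennreal (w t) * (\<integral>\<^sup>+y. ennreal (cmod (f y)) * indicator (ball x t) y \<partial>lborel) * indicator {0<..<2 * \<rho>} t \<partial>lborel)"
    by (intro mult_left_mono nn_integral_ball_layer_cake)
      (auto simp: w_def intro!: divide_left_mono power_mono mult_pos_pos zero_less_power)
  also have "\<dots> \<le> ennreal (2 ^ ?n) * (\<integral>\<^sup>+t. ennreal (?v * maximal_function f x) * indicator {0<..<2 * \<rho>} t \<partial>lborel)"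
  proof (intro mult_left_mono nn_integral_mono)
    fix t :: real
    show "ennreal (w t) * (\<integral>\<^sup>+y. ennreal (cmod (f y)) * indicator (ball x t) y \<partial>lborel) * indicator {0<..<2 * \<rho>} t
        \<le> ennreal (?v * maximal_function f x) * indicator {0<..<2 * \<rho>} t"
    proof (cases "t \<in> {0<..<2 * \<rho>}")
      case True
      then have t: "0 < t" by simp
      have "ennreal (w t) * (\<integral>\<^sup>+y. ennreal (cmod (f y)) * indicator (ball x t) y \<partial>lborel)
          \<le> ennreal (w t) * ennreal (?v * t ^ ?n * maximal_function f x)"
        by (intro mult_left_mono mx t) simp
      also have "\<dots> = ennreal (w t * (?v * t ^ ?n * maximal_function f x))"
        using t by (intro ennreal_mult'[symmetric]) (simp add: w_def)
      also have "w t * (?v * t ^ ?n * maximal_function f x) = ?v * maximal_function f x"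
        using t by (simp add: w_def)
      finally show ?thesis using True by simp
    qed simp
  qed simp
  also have "\<dots> = ennreal (2 ^ ?n) * (ennreal (?v * maximal_function f x) * ennreal (2 * \<rho>))"
    using \<rho> by (subst nn_integral_cmult_indicator) auto
  also have "\<dots> = ennreal (2 ^ ?n * 2 * \<rho> * ?v * maximal_function f x)"
    using \<rho> mx(2)[of x] by (simp add: ennreal_mult'[symmetric] ennreal_mult''[symmetric] mult_ac)
  finally show ?thesis .
qed

section \<open>The majorant for the logarithm\<close>

text \<open>
  The regions \<open>|y| \<le> |x|/2\<close>, \<open>|y| \<ge> 2|x|\<close> and the one in between account for \<open>P\<^sup>2\<close>, \<open>(P\<^sup>*)\<^sup>2\<close> and \<open>M\<close>.
  In the first two \<open>|x-y|\<close> is at least half the larger of \<open>|x|\<close> and \<open>|y|\<close>; in the third it is less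
  than \<open>4|x|\<close>.
\<close>

lemma commutator_majorant_ln_le:
  fixes f :: "'a::euclidean_space \<Rightarrow> complex"
  assumes fm[measurable]: "f \<in> borel_measurable borel" and f: "\<And>y. cmod (f y) \<le> M"
    and fR: "\<And>y. y \<notin> ball 0 R \<Longrightarrow> f y = 0" and R: "0 \<le> R" and x: "x \<noteq> 0"
  shows "commutator_majorant (\<lambda>y. ln (norm y)) f x \<le> ennreal (2 ^ DIM('a) * 16 * unit_ball_vol DIM('a) *
      (maximal_function f x + radial_hardy (radial_hardy (\<lambda>y. cmod (f y))) x
        + radial_hardy_adj (radial_hardy_adj (\<lambda>y. cmod (f y))) x))"
proof -
  let ?v = "unit_ball_vol DIM('a)" and ?n = "DIM('a)"
  define F where "F = (\<lambda>y. cmod (f y))"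
  have [measurable]: "F \<in> borel_measurable borel" unfolding F_def by measurable
  have F: "0 \<le> F y" "F y \<le> M" "R \<le> norm y \<Longrightarrow> F y = 0" for y
    using f fR[of y] by (auto simp: F_def)
  define r where "r = norm x"
  have r: "0 < r" using x by (simp add: r_def)
  let ?P = "radial_hardy (radial_hardy F) x" and ?Q = "radial_hardy_adj (radial_hardy_adj F) x"
  have P0: "0 \<le> ?P"
    unfolding radial_hardy_def set_lebesgue_integral_def
    by (intro scaleR_nonneg_nonneg integral_nonneg_AE AE_I2) (auto simp: F)
  have Q0: "0 \<le> ?Q" by (rule ln_weight_le_radial_hardy_adj_square(2)[OF _ F R x]) auto
  have M0: "0 \<le> maximal_function f x" by (rule ball_average_le_maximal_function(2)[OF fm f])
  define i1 where "i1 y = ennreal (ln (norm x / norm y) * F y) * indicator {y. 0 < norm y \<and> 2 * norm y \<le> norm x} y" for y :: 'a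
  define i2 where "i2 y = ennreal (ln (norm y / norm x) / norm y ^ ?n * F y) * indicator {y. 2 * norm x \<le> norm y} y" for y :: 'a
  define i3 where "i3 y = ennreal (norm (x - y) / norm (x - y) ^ ?n * cmod (f y)) * indicator (ball x (4 * r)) y" for y :: 'a
  have im: "i1 \<in> borel_measurable lborel" "i2 \<in> borel_measurable lborel" "i3 \<in> borel_measurable lborel"
    unfolding i1_def i2_def by measurable
      (unfold i3_def, intro borel_measurable_times_ennreal borel_measurable_indicator; measurable)
  have pw: "ennreal (\<bar>ln (norm x) - ln (norm y)\<bar> / norm (x - y) ^ ?n * cmod (f y))
      \<le> ennreal (2 ^ ?n / r ^ ?n) * i1 y + (ennreal (2 ^ ?n) * i2 y + ennreal (2 / r) * i3 y)" if y: "y \<noteq> 0" for y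
  proof -
    consider (near0) "2 * norm y \<le> r" | (far) "2 * r \<le> norm y" | (mid) "r < 2 * norm y" "norm y < 2 * r" by linarith
    then show ?thesis
    proof cases
      case near0
      have d: "r / 2 \<le> norm (x - y)" using norm_triangle_ineq2[of x y] near0 by (simp add: r_def)
      have "ln (norm y) \<le> ln (norm x)"
        using near0 norm_ge_zero[of y] y r by (subst ln_le_cancel_iff) (auto simp: r_def simp del: norm_ge_zero)
      then have "\<bar>ln (norm x) - ln (norm y)\<bar> = ln (norm x / norm y)"
        using y r by (simp add: r_def ln_div)
      moreover have "1 / norm (x - y) ^ ?n \<le> 1 / (r / 2) ^ ?n"
        using d r by (intro divide_left_mono power_mono mult_pos_pos zero_less_power) auto
      moreover have "0 \<le> ln (norm x / norm y)"
        using \<open>ln (norm y) \<le> ln (norm x)\<close> y r by (simp add: r_def ln_div)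
      ultimately have "\<bar>ln (norm x) - ln (norm y)\<bar> * (1 / norm (x - y) ^ ?n) * F y \<le> ln (norm x / norm y) * (1 / (r / 2) ^ ?n) * F y"
        using F(1)[of y] by (intro mult_right_mono mult_mono) auto
      also have "\<dots> = 2 ^ ?n / r ^ ?n * (ln (norm x / norm y) * F y)" by (simp add: power_divide)
      finally have "ennreal (\<bar>ln (norm x) - ln (norm y)\<bar> / norm (x - y) ^ ?n * cmod (f y)) \<le> ennreal (2 ^ ?n / r ^ ?n * (ln (norm x / norm y) * F y))"
        by (intro ennreal_leI) (simp add: F_def)
      also have "\<dots> = ennreal (2 ^ ?n / r ^ ?n) * i1 y"
        using near0 y r by (subst ennreal_mult') (auto simp: i1_def r_def)
      finally show ?thesis by (simp add: add_increasing2)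
    next
      case far
      have d: "norm y / 2 \<le> norm (x - y)" using norm_triangle_ineq3[of x y] far by (simp add: r_def)
      have ypos: "0 < norm y" using y by simp
      have "ln (norm x) \<le> ln (norm y)"
        using far norm_ge_zero[of x] y r by (subst ln_le_cancel_iff) (auto simp: r_def simp del: norm_ge_zero)
      then have "\<bar>ln (norm x) - ln (norm y)\<bar> = ln (norm y / norm x)"
        using y r by (simp add: r_def ln_div)
      moreover have "1 / norm (x - y) ^ ?n \<le> 1 / (norm y / 2) ^ ?n"
        using d ypos by (intro divide_left_mono power_mono mult_pos_pos zero_less_power) auto
      moreover have "0 \<le> ln (norm y / norm x)"
        using \<open>ln (norm x) \<le> ln (norm y)\<close> y r by (simp add: r_def ln_div)
      ultimately have "\<bar>ln (norm x) - ln (norm y)\<bar> * (1 / norm (x - y) ^ ?n) * F y \<le> ln (norm y / norm x) * (1 / (norm y / 2) ^ ?n) * F y"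
        using F(1)[of y] by (intro mult_right_mono mult_mono) auto
      also have "\<dots> = 2 ^ ?n * (ln (norm y / norm x) / norm y ^ ?n * F y)" by (simp add: power_divide)
      finally have "ennreal (\<bar>ln (norm x) - ln (norm y)\<bar> / norm (x - y) ^ ?n * cmod (f y)) \<le> ennreal (2 ^ ?n * (ln (norm y / norm x) / norm y ^ ?n * F y))"
        by (intro ennreal_leI) (simp add: F_def)
      also have "\<dots> = ennreal (2 ^ ?n) * i2 y"
        using far y r by (subst ennreal_mult') (auto simp: i2_def r_def)
      finally show ?thesis by (simp add: add_increasing add_increasing2)
    next
      case mid
      have ln_lip: "\<bar>ln s - ln t\<bar> \<le> 2 / r * \<bar>s - t\<bar>" if "r / 2 \<le> s" "r / 2 \<le> t" for s t
      proof -
        have *: "ln s - ln t \<le> 2 / r * \<bar>s - t\<bar>" if "r / 2 \<le> s" "r / 2 \<le> t" for s t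
        proof -
          have t: "0 < t" "0 < s" using that r by auto
          have "ln s - ln t \<le> (s - t) / t" using ln_le_minus_one[of "s / t"] t by (simp add: ln_div diff_divide_distrib)
          also have "\<dots> \<le> \<bar>s - t\<bar> / (r / 2)" using that r t by (intro frac_le) auto
          finally show ?thesis by (simp add: mult.commute)
        qed
        from *[OF that] *[OF that(2,1)] show ?thesis by (simp add: abs_minus_commute abs_le_iff)
      qed
      have "\<bar>ln (norm x) - ln (norm y)\<bar> \<le> 2 / r * \<bar>norm x - norm y\<bar>"
        using mid r by (intro ln_lip) (auto simp: r_def)
      also have "\<dots> \<le> 2 / r * norm (x - y)"
        using r norm_triangle_ineq3[of x y] by (intro mult_left_mono) auto
      finally have "\<bar>ln (norm x) - ln (norm y)\<bar> / norm (x - y) ^ ?n * F y \<le> (2 / r * norm (x - y)) / norm (x - y) ^ ?n * F y"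
        using F(1)[of y] by (intro mult_right_mono divide_right_mono) auto
      then have "ennreal (\<bar>ln (norm x) - ln (norm y)\<bar> / norm (x - y) ^ ?n * cmod (f y)) \<le> ennreal (2 / r * (norm (x - y) / norm (x - y) ^ ?n * F y))"
        by (intro ennreal_leI) (simp add: F_def)
      also have "\<dots> = ennreal (2 / r) * ennreal (norm (x - y) / norm (x - y) ^ ?n * F y)"
        using r by (intro ennreal_mult') simp
      also have "\<dots> = ennreal (2 / r) * i3 y"
      proof -
        have "norm (x - y) < 4 * r" using norm_triangle_ineq4[of x y] mid r by (simp add: r_def)
        then show ?thesis by (simp add: i3_def F_def dist_norm)
      qed
      finally show ?thesis by (simp add: add_increasing)
    qed
  qed
  \<comment> \<open>At \<open>y = 0\<close> the value \<open>ln 0 = 0\<close> is meaningless and the pointwise bound is lost.\<close>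
  have "AE y in lborel. y \<noteq> (0::'a)" by (rule AE_lborel_singleton)
  then have "commutator_majorant (\<lambda>y. ln (norm y)) f x \<le>
      (\<integral>\<^sup>+y. ennreal (2 ^ ?n / r ^ ?n) * i1 y + (ennreal (2 ^ ?n) * i2 y + ennreal (2 / r) * i3 y) \<partial>lborel)"
    unfolding commutator_majorant_def by (intro nn_integral_mono_AE) (rule eventually_mono, assumption, rule pw)
  also have "\<dots> = ennreal (2 ^ ?n / r ^ ?n) * (\<integral>\<^sup>+y. i1 y \<partial>lborel)
      + (ennreal (2 ^ ?n) * (\<integral>\<^sup>+y. i2 y \<partial>lborel) + ennreal (2 / r) * (\<integral>\<^sup>+y. i3 y \<partial>lborel))"
    using im by (simp add: nn_integral_add nn_integral_cmult)
  also have "\<dots> \<le> ennreal (2 ^ ?n / r ^ ?n) * ennreal (4 * ?v * norm x ^ ?n * ?P)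
      + (ennreal (2 ^ ?n) * ennreal (4 * ?v * ?Q) + ennreal (2 / r) * ennreal (2 ^ ?n * 2 * (4 * r) * ?v * maximal_function f x))"
    unfolding i1_def i2_def i3_def
    by (intro add_mono mult_left_mono ln_weight_le_radial_hardy_square[OF _ F(1,2) x]
        ln_weight_le_radial_hardy_adj_square(1)[OF _ F R x] weakly_singular_le_maximal_function[OF fm f]) (use r in auto)
  also have "\<dots> = ennreal (2 ^ ?n / r ^ ?n * (4 * ?v * norm x ^ ?n * ?P)
      + (2 ^ ?n * (4 * ?v * ?Q) + 2 / r * (2 ^ ?n * 2 * (4 * r) * ?v * maximal_function f x)))"
    using r P0 Q0 M0 by (simp add: ennreal_mult[symmetric] ennreal_plus[symmetric] del: ennreal_plus)
  also have "\<dots> \<le> ennreal (2 ^ ?n * 16 * ?v * (maximal_function f x + ?P + ?Q))"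
  proof (rule ennreal_leI)
    have "2 ^ ?n / r ^ ?n * (4 * ?v * norm x ^ ?n * ?P) = 2 ^ ?n * ?v * (4 * ?P)"
      using r by (simp add: r_def)
    moreover have "2 / r * (2 ^ ?n * 2 * (4 * r) * ?v * maximal_function f x) = 2 ^ ?n * ?v * (16 * maximal_function f x)"
      using r by simp
    moreover have "2 ^ ?n * ?v * (4 * ?P + 4 * ?Q + 16 * maximal_function f x) \<le> 2 ^ ?n * ?v * (16 * (maximal_function f x + ?P + ?Q))"
      using P0 Q0 by (intro mult_left_mono) (auto simp: less_imp_le)
    ultimately show "2 ^ ?n / r ^ ?n * (4 * ?v * norm x ^ ?n * ?P)
      + (2 ^ ?n * (4 * ?v * ?Q) + 2 / r * (2 ^ ?n * 2 * (4 * r) * ?v * maximal_function f x))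
      \<le> 2 ^ ?n * 16 * ?v * (maximal_function f x + ?P + ?Q)"
      by (simp add: algebra_simps)
  qed
  finally show ?thesis by (simp add: F_def)
qed

section \<open>The commutator with the logarithm\<close>

text \<open>
  Boundedness and linearity of \<open>T\<close> are available on \<open>L\<^sup>2\<close> only, and the commutator applies \<open>T\<close> to this
  product, which is singular at the origin when \<open>f 0 \<noteq> 0\<close>.
\<close>

lemma ln_norm_mult_L2:
  fixes f :: "'a::euclidean_space \<Rightarrow> complex"
  assumes fm[measurable]: "f \<in> borel_measurable borel" and f: "\<And>y. cmod (f y) \<le> M"
    and fR: "\<And>y. y \<notin> ball 0 R \<Longrightarrow> f y = 0" and R: "0 < R"
  shows "(\<lambda>y. complex_of_real (ln (norm y)) * f y) \<in> L2"
proof -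
  have M: "0 \<le> M" using f[of 0] norm_ge_zero order_trans by blast
  let ?g = "\<lambda>y. complex_of_real (ln (norm y)) * f y"
  have gm: "?g \<in> borel_measurable borel" by measurable
  have "(\<integral>\<^sup>+y. ennreal ((cmod (?g y))\<^sup>2) \<partial>lebesgue) = (\<integral>\<^sup>+y. ennreal ((cmod (?g y))\<^sup>2) \<partial>lborel)"
    by (rule nn_integral_completion)
  also have "\<dots> \<le> (\<integral>\<^sup>+y. ennreal (M\<^sup>2) * (ennreal ((ln (norm y))\<^sup>2) * indicator (ball (0::'a) R) y) \<partial>lborel)"
  proof (rule nn_integral_mono)
    fix y :: 'a
    show "ennreal ((cmod (?g y))\<^sup>2) \<le> ennreal (M\<^sup>2) * (ennreal ((ln (norm y))\<^sup>2) * indicator (ball 0 R) y)"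
    proof (cases "y \<in> ball 0 R")
      case True
      have "(cmod (?g y))\<^sup>2 \<le> M\<^sup>2 * (ln (norm y))\<^sup>2"
        using mult_right_mono[OF power_mono[OF f norm_ge_zero, of y 2], of "(ln (norm y))\<^sup>2"]
        by (simp add: norm_mult power_mult_distrib mult.commute)
      then have "ennreal ((cmod (?g y))\<^sup>2) \<le> ennreal (M\<^sup>2 * (ln (norm y))\<^sup>2)" by (rule ennreal_leI)
      then show ?thesis using True by (simp add: ennreal_mult')
    qed (simp add: fR)
  qed
  also have "\<dots> = ennreal (M\<^sup>2) * (\<integral>\<^sup>+y. ennreal ((ln (norm y))\<^sup>2) * indicator (ball (0::'a) R) y \<partial>lborel)"
    by (rule nn_integral_cmult) (intro borel_measurable_times_ennreal borel_measurable_indicator; simp)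
  also have "\<dots> < \<infinity>"
    using ln_norm_square_integrable_ball[OF R, where 'a = 'a] by (simp add: ennreal_mult_less_top)
  finally have "integrable lebesgue (\<lambda>y. (cmod (?g y))\<^sup>2)"
    using borel_imp_lebesgue[OF gm] by (intro integrableI_nonneg) auto
  with borel_imp_lebesgue[OF gm] show ?thesis by (simp add: L2_def)
qed

text \<open>
  The Holder estimate in the second variable gives the continuity.
\<close>

lemma standard_kernel_nonneg_continuous:
  fixes K :: "'a::euclidean_space \<Rightarrow> 'a \<Rightarrow> complex"
  assumes "standard_kernel K"
  obtains C where "0 \<le> C" "\<And>x y. x \<noteq> y \<Longrightarrow> cmod (K x y) \<le> C / norm (x - y) ^ DIM('a)"
    "\<And>x. continuous_on (- {x}) (K x)"
proof -
  obtain C \<delta> where \<delta>: "\<delta> > 0"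
    and size: "\<And>x y. x \<noteq> y \<Longrightarrow> cmod (K x y) \<le> C / norm (x - y) ^ DIM('a)"
    and reg: "\<And>x y y'. x \<noteq> y \<Longrightarrow> norm (y - y') \<le> norm (x - y) / 2 \<Longrightarrow>
      cmod (K x y - K x y') \<le> C * norm (y - y') powr \<delta> / norm (x - y) powr (real DIM('a) + \<delta>)"
    using assms unfolding standard_kernel_def by blast
  obtain e :: 'a where e: "e \<in> Basis" using nonempty_Basis by blast
  have "e \<noteq> 0" using e by auto
  then have "0 \<le> C / norm (e - 0) ^ DIM('a)" using order_trans[OF norm_ge_zero size] by blast
  then have C: "0 \<le> C" using e by simp
  have "continuous_on (- {x}) (K x)" for x
    unfolding continuous_on_def
  proof
    fix y assume "y \<in> - {x}"
    then have xy: "x \<noteq> y" by auto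
    have "((\<lambda>y'. norm (y - y')) \<longlongrightarrow> norm (y - y)) (at y within - {x})" by (intro tendsto_intros)
    then have n0: "((\<lambda>y'. norm (y - y')) \<longlongrightarrow> 0) (at y within - {x})" by simp
    have "((\<lambda>y'. C * norm (y - y') powr \<delta> / norm (x - y) powr (real DIM('a) + \<delta>)) \<longlongrightarrow>
        C * 0 powr \<delta> / norm (x - y) powr (real DIM('a) + \<delta>)) (at y within - {x})"
      using \<delta> xy by (intro tendsto_intros tendsto_powr' n0) auto
    then have lim: "((\<lambda>y'. C * norm (y - y') powr \<delta> / norm (x - y) powr (real DIM('a) + \<delta>)) \<longlongrightarrow> 0) (at y within - {x})"
      by simp
    have "eventually (\<lambda>y'. norm (y - y') < norm (x - y) / 2) (at y within - {x})"
      using order_tendstoD(2)[OF n0, of "norm (x - y) / 2"] xy by simp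
    then have "eventually (\<lambda>y'. cmod (K x y - K x y') \<le> C * norm (y - y') powr \<delta> / norm (x - y) powr (real DIM('a) + \<delta>)) (at y within - {x})"
      by eventually_elim (auto intro: reg[OF xy])
    then have "((\<lambda>y'. cmod (K x y - K x y')) \<longlongrightarrow> 0) (at y within - {x})"
      by (intro tendsto_sandwich[OF _ _ tendsto_const lim]) (auto intro: always_eventually)
    then show "(K x \<longlongrightarrow> K x y) (at y within - {x})"
      using tendsto_norm_zero_cancel LIM_zero_cancel by (subst tendsto_iff) (simp add: tendsto_iff dist_norm norm_minus_commute)
  qed
  with that C size show thesis by blast
qed

lemma calderon_zygmund_operator_kernel:
  assumes "calderon_zygmund_operator T"
  obtains K C A where "calderon_zygmund_kernel T K C A"
proof -
  obtain K where K: "standard_kernel K"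
    and rep: "\<And>f. f \<in> test_functions \<Longrightarrow> AE x in lebesgue. x \<notin> supp f \<longrightarrow> T f x = (LINT y|lebesgue. K x y * f y)"
    using assms unfolding calderon_zygmund_operator_def singular_integral_operator_def by blast
  obtain A where A: "\<And>f. f \<in> L2 \<Longrightarrow> T f \<in> L2 \<and> L2_norm (T f) \<le> A * L2_norm f"
    using assms unfolding calderon_zygmund_operator_def by blast
  obtain C where C: "0 \<le> C" "\<And>x y. x \<noteq> y \<Longrightarrow> cmod (K x y) \<le> C / norm (x - y) ^ DIM('a)"
    "\<And>x. continuous_on (- {x}) (K x)"
    by (rule standard_kernel_nonneg_continuous[OF K]) blast
  have "calderon_zygmund_kernel T K C (max A 0)"
  proof
    fix f g :: "'a \<Rightarrow> complex" and \<alpha> \<beta> assume "f \<in> L2" "g \<in> L2"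
    then show "AE x in lebesgue. T (\<lambda>y. \<alpha> * f y + \<beta> * g y) x = \<alpha> * T f x + \<beta> * T g x"
      using assms unfolding calderon_zygmund_operator_def linear_operator_on_def by blast
  next
    fix f :: "'a \<Rightarrow> complex" assume f: "f \<in> L2"
    show "T f \<in> L2" using A[OF f] by simp
    have "A * L2_norm f \<le> max A 0 * L2_norm f" by (intro mult_right_mono L2_norm_nonneg) simp
    then show "L2_norm (T f) \<le> max A 0 * L2_norm f" using A[OF f] by linarith
  qed (use C rep in auto)
  then show thesis by (rule that)
qed

theorem proposition3p1:
  fixes T :: "(real ^ 'n) operator"
  assumes "calderon_zygmund_operator T"
  shows "\<exists>C>0. \<forall>f\<in>test_functions. AE x in lebesgue.
    cmod (commutator (\<lambda>y. complex_of_real (ln (norm y))) T f x)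
      \<le> C * (maximal_function f x
             + (radial_hardy ^^ 2) (\<lambda>y. cmod (f y)) x
             + (radial_hardy_adj ^^ 2) (\<lambda>y. cmod (f y)) x)"
proof -
  obtain K C A where "calderon_zygmund_kernel T K C A"
    by (rule calderon_zygmund_operator_kernel[OF assms])
  then interpret calderon_zygmund_kernel T K C A .
  define D where "D = 2 ^ DIM(real ^ 'n) * 16 * unit_ball_vol DIM(real ^ 'n)"
  have D: "0 < D" by (simp add: D_def)
  have main: "AE x in lebesgue. cmod (commutator (\<lambda>y. complex_of_real (ln (norm y))) T f x)
      \<le> (C * D + 1) * (maximal_function f x
             + (radial_hardy ^^ 2) (\<lambda>y. cmod (f y)) x
             + (radial_hardy_adj ^^ 2) (\<lambda>y. cmod (f y)) x)" if f: "f \<in> test_functions" for f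
  proof -
    have cont: "continuous_on UNIV f" by (rule test_functions_continuous[OF f])
    have fm: "f \<in> borel_measurable borel" using cont by (rule borel_measurable_continuous_onI)
    have comp: "compact (supp f)" using f by (simp add: test_functions_def)
    have supp: "f y = 0" if "y \<notin> supp f" for y
      using that closure_subset[of "{x. f x \<noteq> 0}"] by (auto simp: supp_def)
    obtain R where R: "0 < R" "supp f \<subseteq> ball 0 R"
      using bounded_subset_ballD[OF compact_imp_bounded[OF comp], of 0] by blast
    have fR: "f y = 0" if "y \<notin> ball 0 R" for y using supp R that by blast
    have "bounded (f ` supp f)"
      by (intro compact_imp_bounded compact_continuous_image comp continuous_on_subset[OF cont]) simp
    then obtain M where M: "0 < M" "\<And>y. y \<in> supp f \<Longrightarrow> cmod (f y) \<le> M"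
      unfolding bounded_pos by blast
    have fM: "cmod (f y) \<le> M" for y using M supp[of y] by (cases "y \<in> supp f") auto
    have fL: "f \<in> L2"
    proof (rule L2_bounded_by[OF borel_imp_lebesgue[OF fm]])
      have i: "(indicator (ball 0 R) :: real ^ 'n \<Rightarrow> complex) \<in> L2" by (rule indicator_L2) auto
      then show "(\<lambda>y::real ^ 'n. of_real M * indicator (ball 0 R) y :: complex) \<in> L2"
        using L2_scaled_add[OF i i, of "of_real M" 0] by simp
      show "cmod (f y) \<le> cmod (of_real M * indicator (ball 0 R) y)" for y
        using fM[of y] fR[of y] M(1) by (cases "y \<in> ball 0 R") (auto simp: norm_mult)
    qed
    have bL: "(\<lambda>y. complex_of_real (ln (norm y)) * f y) \<in> L2"
      by (rule ln_norm_mult_L2[OF fm fM fR R(1)])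
    have "AE x in lebesgue. x \<in> - {0} \<longrightarrow> ennreal (cmod (commutator (\<lambda>y. complex_of_real (ln (norm y))) T f x))
        \<le> ennreal C * commutator_majorant (\<lambda>y. ln (norm y)) f x"
      by (rule commutator_le_majorant[OF _ fm fM fR fL bL]) (auto intro!: continuous_intros)
    moreover have "AE x in lebesgue. x \<noteq> (0::real ^ 'n)" by (intro AE_completion AE_lborel_singleton)
    ultimately show ?thesis
    proof eventually_elim
      case (elim x)
      let ?B = "maximal_function f x + radial_hardy (radial_hardy (\<lambda>y. cmod (f y))) x
          + radial_hardy_adj (radial_hardy_adj (\<lambda>y. cmod (f y))) x"
      have B: "0 \<le> ?B"
      proof -
        have "0 \<le> maximal_function f x" by (rule ball_average_le_maximal_function(2)[OF fm fM])
        moreover have "0 \<le> radial_hardy (radial_hardy (\<lambda>y. cmod (f y))) x"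
          "0 \<le> radial_hardy_adj (radial_hardy_adj (\<lambda>y. cmod (f y))) x"
          unfolding radial_hardy_def radial_hardy_adj_def set_lebesgue_integral_def
          by (intro scaleR_nonneg_nonneg integral_nonneg_AE AE_I2; simp)+
        ultimately show ?thesis by simp
      qed
      have "ennreal (cmod (commutator (\<lambda>y. complex_of_real (ln (norm y))) T f x))
        \<le> ennreal C * commutator_majorant (\<lambda>y. ln (norm y)) f x" using elim by simp
      also have "\<dots> \<le> ennreal C * ennreal (D * ?B)"
        unfolding D_def
        by (intro mult_left_mono commutator_majorant_ln_le[OF fm fM fR]) (use elim R in auto)
      also have "\<dots> = ennreal (C * (D * ?B))" using C_nonneg by (rule ennreal_mult'[symmetric])
      finally have "cmod (commutator (\<lambda>y. complex_of_real (ln (norm y))) T f x) \<le> C * (D * ?B)"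
        using C_nonneg D B by (subst (asm) ennreal_le_iff) auto
      also have "\<dots> \<le> (C * D + 1) * ?B" using B by (simp add: algebra_simps)
      finally show ?case by (simp add: numeral_2_eq_2)
    qed
  qed
  show ?thesis
    by (rule exI[of _ "C * D + 1"]) (use main C_nonneg D in \<open>auto intro: add_nonneg_pos\<close>)
qed

end
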